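(* Let $(x^*,u^* )$ be a local solution of problem (P) with radius $\delta>0$. Then for every $k>0$ the regularized optimal control problem $(P_k)$ admits a global solution $(x_k,u_k)$.
   Context: Let $n,m\ge1$, $T>0$, $\tau>0$, $I=[0,T]$, $I_\tau=[-\tau,T]$. For $x\in C(I_\tau;\mathbb{R}^n)$, $t\in I$: $\max x_t:=\max_{s\in[t-\tau,t]}x(s)$ and $\mathrm{LIE}_k(x_t):=\frac1k\log\big(\int_{t-\tau}^t\exp(kx(s))\,\mathrm{d}s\big)$, both componentwise. Standing assumptions: $F(x,v,u)=F_0(x,v)+F_1(x,v)u$ with $F_0:\mathbb{R}^n\times\mathbb{R}^n\to\mathbb{R}^n$, $F_1:\mathbb{R}^n\times\mathbb{R}^n\to\mathbb{R}^{n\times m}$ globally Lipschitz and $C^1$; $\phi\in C([-\tau,0];\mathbb{R}^n)$; $U\subset\mathbb{R}^m$ nonempty convex compact; $j:I\times\mathbb{R}^n\times\mathbb{R}^m\to\mathbb{R}$ a nonnegative normal integrand, convex in its third argument, differentiable in its second argument with $j_x$ continuous in the second and third arguments. Feasible controls: $u\in L^\infty(I;\mathbb{R}^m)$ with $u(t)\in U$ a.e. Problem (P): minimize $J(x,u)=\int_0^Tj(t,x(t),u(t))\,\mathrm{d}t$ over feasible $u$, where $x\in C(I_\tau;\mathbb{R}^n)\cap W^{1,\infty}(I;\mathbb{R}^n)$ solves $x'(t)=F(x(t),\max x_t,u(t))$ a.e. on $(0,T)$, $x=\phi$ on $[-\tau,0]$. A local solution of (P) with radius $\delta>0$: feasible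 $u^*$ with state $x^*$ such that $J(x^*,u^* )\le J(x,u)$ for all feasible $u$ with $\|u-u^*\|_{L^2(I;\mathbb{R}^m)}\le\delta$. Problem $(P_k)$: minimize $J(x,u)+\frac12\|u-u^*\|^2_{L^2(I;\mathbb{R}^m)}=\int_0^T j(t,x(t),u(t))+\frac12|u(t)-u^*(t)|^2\,\mathrm{d}t$ over feasible $u$ with $\|u-u^*\|_{L^2(I;\mathbb{R}^m)}\le\delta$, where $x$ solves the regularized equation $x'(t)=F(x(t),\mathrm{LIE}_k(x_t),u(t))$ a.e. on $I$, $x=\phi$ on $[-\tau,0]$. *)

theory Defs
  imports "HOL-Analysis.Analysis"
begin

definition maxdelay :: "real \<Rightarrow> (real \<Rightarrow> real^'n) \<Rightarrow> real \<Rightarrow> real^'n" where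
  "maxdelay tau x t = (\<chi> i. Sup ((\<lambda>s. x s $ i) ` {t - tau..t}))"

definition LIE :: "real \<Rightarrow> real \<Rightarrow> (real \<Rightarrow> real^'n) \<Rightarrow> real \<Rightarrow> real^'n" where
  "LIE k tau x t = (\<chi> i. (1 / k) * ln (integral {t - tau..t} (\<lambda>s. exp (k * x s $ i))))"

definition rhs :: "(real^'n \<Rightarrow> real^'n \<Rightarrow> real^'n) \<Rightarrow> (real^'n \<Rightarrow> real^'n \<Rightarrow> real^'m^'n)
    \<Rightarrow> real^'n \<Rightarrow> real^'n \<Rightarrow> real^'m \<Rightarrow> real^'n" where
  "rhs F0 F1 x v u = F0 x v + F1 x v *v u"

text \<open>x in C([-tau,T]) and W^{1,inf}(0,T) (= Lipschitz on [0,T]) solving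
  x'(t) = F(x(t), D x t, u(t)) a.e. on (0,T), x = phi on [-tau,0];
  D is the delay operator (maxdelay tau or LIE k tau).\<close>
definition solves_delay ::
  "(real^'n \<Rightarrow> real^'n \<Rightarrow> real^'n) \<Rightarrow> (real^'n \<Rightarrow> real^'n \<Rightarrow> real^'m^'n)
   \<Rightarrow> ((real \<Rightarrow> real^'n) \<Rightarrow> real \<Rightarrow> real^'n)
   \<Rightarrow> real \<Rightarrow> real \<Rightarrow> (real \<Rightarrow> real^'n) \<Rightarrow> (real \<Rightarrow> real^'m) \<Rightarrow> (real \<Rightarrow> real^'n) \<Rightarrow> bool" where
  "solves_delay F0 F1 D tau T phi u x \<longleftrightarrow>
     continuous_on {-tau..T} x \<and>
     (\<exists>L. L-lipschitz_on {0..T} x) \<and>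
     (\<forall>s\<in>{-tau..0}. x s = phi s) \<and>
     (AE t in lebesgue_on {0<..<T}. (x has_vector_derivative rhs F0 F1 (x t) (D x t) (u t)) (at t))"

definition feasible :: "real \<Rightarrow> (real^'m) set \<Rightarrow> (real \<Rightarrow> real^'m) \<Rightarrow> bool" where
  "feasible T U u \<longleftrightarrow>
     u \<in> borel_measurable (lebesgue_on {0..T}) \<and>
     (\<exists>B. AE t in lebesgue_on {0..T}. norm (u t) \<le> B) \<and>
     (AE t in lebesgue_on {0..T}. u t \<in> U)"

definition L2dist :: "real \<Rightarrow> (real \<Rightarrow> real^'m) \<Rightarrow> (real \<Rightarrow> real^'m) \<Rightarrow> real" where
  "L2dist T u v = sqrt (integral\<^sup>L (lebesgue_on {0..T}) (\<lambda>t. (norm (u t - v t))\<^sup>2))"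

definition Jcost :: "real \<Rightarrow> (real \<Rightarrow> real^'n \<Rightarrow> real^'m \<Rightarrow> real)
    \<Rightarrow> (real \<Rightarrow> real^'n) \<Rightarrow> (real \<Rightarrow> real^'m) \<Rightarrow> ennreal" where
  "Jcost T j x u = (\<integral>\<^sup>+ t. ennreal (j t (x t) (u t)) \<partial>lebesgue_on {0..T})"

text \<open>Normal integrand (real-valued, on the complete measure space ([0,T], Lebesgue)):
  jointly L x B measurable and lower semicontinuous in (x,u) for each t.\<close>
definition normal_integrand :: "real \<Rightarrow> (real \<Rightarrow> real^'n \<Rightarrow> real^'m \<Rightarrow> real) \<Rightarrow> bool" where
  "normal_integrand T j \<longleftrightarrow>
     (\<lambda>(t, z). j t (fst z) (snd z)) \<in> borel_measurable (lebesgue_on {0..T} \<Otimes>\<^sub>M borel) \<and>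
     (\<forall>t\<in>{0..T}. \<forall>z. \<forall>c < j t (fst z) (snd z). eventually (\<lambda>y. c < j t (fst y) (snd y)) (at z))"

definition local_solution_P ::
  "(real^'n \<Rightarrow> real^'n \<Rightarrow> real^'n) \<Rightarrow> (real^'n \<Rightarrow> real^'n \<Rightarrow> real^'m^'n)
   \<Rightarrow> real \<Rightarrow> real \<Rightarrow> (real \<Rightarrow> real^'n) \<Rightarrow> (real^'m) set
   \<Rightarrow> (real \<Rightarrow> real^'n \<Rightarrow> real^'m \<Rightarrow> real) \<Rightarrow> real
   \<Rightarrow> (real \<Rightarrow> real^'n) \<Rightarrow> (real \<Rightarrow> real^'m) \<Rightarrow> bool" where
  "local_solution_P F0 F1 tau T phi U j \<delta> xs us \<longleftrightarrow>
     feasible T U us \<and> solves_delay F0 F1 (maxdelay tau) tau T phi us xs \<and>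
     (\<forall>u x. feasible T U u \<and> L2dist T u us \<le> \<delta> \<and> solves_delay F0 F1 (maxdelay tau) tau T phi u x
        \<longrightarrow> Jcost T j xs us \<le> Jcost T j x u)"

definition Jk_cost :: "real \<Rightarrow> (real \<Rightarrow> real^'n \<Rightarrow> real^'m \<Rightarrow> real) \<Rightarrow> (real \<Rightarrow> real^'m)
    \<Rightarrow> (real \<Rightarrow> real^'n) \<Rightarrow> (real \<Rightarrow> real^'m) \<Rightarrow> ennreal" where
  "Jk_cost T j us x u = Jcost T j x u + ennreal ((L2dist T u us)\<^sup>2 / 2)"

definition global_solution_Pk ::
  "(real^'n \<Rightarrow> real^'n \<Rightarrow> real^'n) \<Rightarrow> (real^'n \<Rightarrow> real^'n \<Rightarrow> real^'m^'n)
   \<Rightarrow> real \<Rightarrow> real \<Rightarrow> real \<Rightarrow> (real \<Rightarrow> real^'n) \<Rightarrow> (real^'m) set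
   \<Rightarrow> (real \<Rightarrow> real^'n \<Rightarrow> real^'m \<Rightarrow> real) \<Rightarrow> real \<Rightarrow> (real \<Rightarrow> real^'m)
   \<Rightarrow> (real \<Rightarrow> real^'n) \<Rightarrow> (real \<Rightarrow> real^'m) \<Rightarrow> bool" where
  "global_solution_Pk F0 F1 k tau T phi U j \<delta> us xk uk \<longleftrightarrow>
     feasible T U uk \<and> L2dist T uk us \<le> \<delta> \<and> solves_delay F0 F1 (LIE k tau) tau T phi uk xk \<and>
     (\<forall>u x. feasible T U u \<and> L2dist T u us \<le> \<delta> \<and> solves_delay F0 F1 (LIE k tau) tau T phi u x
        \<longrightarrow> Jk_cost T j us xk uk \<le> Jk_cost T j us x u)"

end

theory Submission
  imports Defs "HOL-Complex_Analysis.Great_Picard"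
begin

text \<open>
  Direct method without weak topologies. Solutions of the regularized equation belonging to
  admissible controls are uniformly bounded and uniformly Lipschitz, so the states of a minimizing
  sequence converge uniformly along a subsequence (Arzela--Ascoli). Nearly norm-minimal convex
  combinations of the tails of the controls are Cauchy in mean square by the parallelogram law, and
  a subsequence of them converges almost everywhere (this replaces weak compactness together with
  Mazur's lemma). Averaging the integral equations with the same weights gives the equation for the
  limit, because the dynamics are affine in the control. The cost is lower semicontinuous because
  it is convex in the control, locally Lipschitz in the state, and Fatou's lemma applies.
\<close>

section \<open>Convergent convex combinations of tails\<close>

text \<open>The dynamics are nonlinear and the cost need not be convex in the state, so averaging
  states along with controls need not produce a solution or a cost estimate. Instead velocities and
  running costs are averaged, pointwise in time and with one common family of weights, and are
  compared with their values at the uniform limit \<open>y\<close> of the states. The error of this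
  replacement tends to zero at each time, and averages inherit this because the weights of the
  \<open>i\<close>-th combination live on indices at least \<open>i\<close>. Once the state is
  frozen, affinity of the dynamics and convexity of the cost move the average onto the control.
  Tails also preserve minimality: costs along the sequence decrease, so a tail average stays below
  every earlier cost. The weights are chosen from the controls alone, after the states have been
  made to converge, and hence serve all these purposes at once.\<close>

definition tail_weights :: "nat \<Rightarrow> (nat \<times> (nat \<Rightarrow> real)) set" where
  "tail_weights i = {(N, w). (\<forall>j. 0 \<le> w j) \<and> (\<forall>j<i. w j = 0) \<and> (\<forall>j\<ge>N. w j = 0) \<and> (\<Sum>j<N. w j) = 1}"

text \<open>The cutoff \<open>N\<close> is stored with the weights, so this is a finite sum over an
  explicit range in any real vector space. One pair \<open>p\<close> can therefore average controls,
  velocities, states and costs alike.\<close>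

definition wsum :: "nat \<times> (nat \<Rightarrow> real) \<Rightarrow> (nat \<Rightarrow> 'b::real_vector) \<Rightarrow> 'b" where
  "wsum p f = (\<Sum>j<fst p. snd p j *\<^sub>R f j)"

lemma tail_weights_mono: "i \<le> j \<Longrightarrow> tail_weights j \<subseteq> tail_weights i"
  by (auto simp: tail_weights_def)

lemma tail_weights_nonempty: "tail_weights i \<noteq> {}"
proof -
  have "(Suc i, \<lambda>j. if j = i then 1 else 0) \<in> tail_weights i"
    by (auto simp: tail_weights_def)
  then show ?thesis by blast
qed

text \<open>Makes the midpoint of two near-minimizers a competitor in the norm minimization below.
  The identity holds for every \<open>f\<close>, hence at all points of the measure space with the
  same \<open>r\<close>.\<close>

lemma tail_weights_midpoint:
  assumes "p \<in> tail_weights i" "q \<in> tail_weights i"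
  obtains r where "r \<in> tail_weights i"
    "\<And>f :: nat \<Rightarrow> 'b::real_vector. wsum r f = (1/2) *\<^sub>R (wsum p f + wsum q f)"
proof -
  obtain N w where p: "p = (N, w)" "\<And>j. 0 \<le> w j" "\<And>j. j < i \<Longrightarrow> w j = 0" "\<And>j. j \<ge> N \<Longrightarrow> w j = 0" "(\<Sum>j<N. w j) = 1"
    using assms(1) by (auto simp: tail_weights_def)
  obtain N' w' where q: "q = (N', w')" "\<And>j. 0 \<le> w' j" "\<And>j. j < i \<Longrightarrow> w' j = 0" "\<And>j. j \<ge> N' \<Longrightarrow> w' j = 0" "(\<Sum>j<N'. w' j) = 1"
    using assms(2) by (auto simp: tail_weights_def)
  \<comment> \<open>Padding both weight vectors with zeros up to \<open>K\<close> lets them be added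
    termwise.\<close>
  define K where "K = max N N'"
  have 1: "(\<Sum>j<K. w j) = 1" "(\<Sum>j<K. w' j) = 1"
    using p(5) q(5) sum.mono_neutral_left[of "{..<K}" "{..<N}" w] sum.mono_neutral_left[of "{..<K}" "{..<N'}" w'] p(4) q(4)
    by (auto simp: K_def)
  have 2: "(\<Sum>j<N. w j *\<^sub>R f j) = (\<Sum>j<K. w j *\<^sub>R f j)" "(\<Sum>j<N'. w' j *\<^sub>R f j) = (\<Sum>j<K. w' j *\<^sub>R f j)"
    for f :: "nat \<Rightarrow> 'b"
    subgoal by (rule sum.mono_neutral_left) (use p(4) in \<open>auto simp: K_def not_less\<close>)
    subgoal by (rule sum.mono_neutral_left) (use q(4) in \<open>auto simp: K_def not_less\<close>)
    done
  show thesis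
  proof
    show "(K, \<lambda>j. (w j + w' j) / 2) \<in> tail_weights i"
      using p q 1 by (auto simp: tail_weights_def K_def sum.distrib simp flip: sum_divide_distrib)
    show "wsum (K, \<lambda>j. (w j + w' j) / 2) f = (1/2) *\<^sub>R (wsum p f + wsum q f)" for f :: "nat \<Rightarrow> 'b"
      unfolding wsum_def p(1) q(1) fst_conv snd_conv 2
      by (simp add: scaleR_sum_right scaleR_add_right sum.distrib add_divide_distrib scaleR_add_left)
  qed
qed

lemma wsum_const: "p \<in> tail_weights i \<Longrightarrow> wsum p (\<lambda>_. c) = c"
  by (auto simp: tail_weights_def wsum_def simp flip: scaleR_sum_left)

lemma wsum_diff: "wsum p (\<lambda>j. f j - g j) = wsum p f - wsum p g"
  by (simp add: wsum_def sum_subtractf scaleR_diff_right)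

lemma linear_wsum: "linear h \<Longrightarrow> h (wsum p f) = wsum p (\<lambda>j. h (f j))"
  by (simp add: wsum_def linear_sum linear_scale)

lemma wsum_mono:
  fixes f g :: "nat \<Rightarrow> real"
  assumes "p \<in> tail_weights i" "\<And>j. j \<ge> i \<Longrightarrow> f j \<le> g j"
  shows "wsum p f \<le> wsum p g"
  unfolding wsum_def
proof (rule sum_mono)
  fix j assume "j \<in> {..<fst p}"
  show "snd p j *\<^sub>R f j \<le> snd p j *\<^sub>R g j"
    using assms by (cases "j < i") (auto simp: tail_weights_def intro: mult_left_mono)
qed

lemma norm_wsum_le:
  assumes "p \<in> tail_weights i"
  shows "norm (wsum p f) \<le> wsum p (\<lambda>j. norm (f j))"
  unfolding wsum_def
  by (rule order_trans[OF norm_sum]) (use assms in \<open>auto simp: tail_weights_def intro!: sum_mono\<close>)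

lemma norm_wsum_le_bound:
  assumes "p \<in> tail_weights i" "\<And>j. norm (f j) \<le> B"
  shows "norm (wsum p f) \<le> B"
proof -
  have "norm (wsum p f) \<le> wsum p (\<lambda>j. norm (f j))" by (rule norm_wsum_le[OF assms(1)])
  also have "\<dots> \<le> wsum p (\<lambda>_. B)" by (rule wsum_mono[OF assms(1)]) (rule assms(2))
  finally show ?thesis using wsum_const[OF assms(1), of B] by simp
qed

lemma convex_wsum:
  assumes "p \<in> tail_weights i" "convex C" "\<And>j. f j \<in> C"
  shows "wsum p f \<in> C"
  unfolding wsum_def by (rule convex_sum) (use assms in \<open>auto simp: tail_weights_def\<close>)

lemma convex_on_wsum:
  assumes "p \<in> tail_weights i" "convex_on C h" "\<And>j. f j \<in> C"
  shows "h (wsum p f) \<le> wsum p (\<lambda>j. h (f j))"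
proof -
  have "fst p \<noteq> 0" using assms(1) by (auto simp: tail_weights_def intro!: Nat.gr0I)
  then have "{..<fst p} \<noteq> {}" by auto
  then show ?thesis
    unfolding wsum_def real_scaleR_def
    by (intro convex_on_sum) (use assms in \<open>auto simp: tail_weights_def\<close>)
qed

text \<open>Weights from \<open>tail_weights i\<close> vanish below \<open>i\<close>, so for large
  \<open>i\<close> only small entries of \<open>e\<close> are averaged.\<close>

lemma wsum_tendsto_zero:
  fixes e :: "nat \<Rightarrow> real"
  assumes w: "\<And>i. w i \<in> tail_weights i" and e: "e \<longlonglongrightarrow> 0"
  shows "(\<lambda>i. wsum (w i) e) \<longlonglongrightarrow> 0"
proof (rule LIMSEQ_I)
  fix r :: real assume "r > 0"
  then obtain n where n: "\<And>j. j \<ge> n \<Longrightarrow> norm (e j) < r/2"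
    using LIMSEQ_D[OF e, of "r/2"] by auto
  have "norm (wsum (w i) e - 0) < r" if "i \<ge> n" for i
  proof -
    have "norm (wsum (w i) e) \<le> wsum (w i) (\<lambda>j. norm (e j))" by (rule norm_wsum_le[OF w])
    also have "\<dots> \<le> wsum (w i) (\<lambda>j. r/2)"
      using n that by (intro wsum_mono[OF w]) (auto intro: less_imp_le)
    finally show ?thesis using \<open>r > 0\<close> wsum_const[OF w, of i "r/2"] by simp
  qed
  then show "\<exists>no. \<forall>i\<ge>no. norm (wsum (w i) e - 0) < r" by blast
qed

lemma wsum_tendsto:
  fixes f :: "nat \<Rightarrow> 'b::real_normed_vector"
  assumes w: "\<And>i. w i \<in> tail_weights i" and f: "f \<longlonglongrightarrow> l"
  shows "(\<lambda>i. wsum (w i) f) \<longlonglongrightarrow> l"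
proof -
  have "(\<lambda>j. norm (f j - l)) \<longlonglongrightarrow> 0"
    using f by (simp add: tendsto_norm_zero LIM_zero)
  from wsum_tendsto_zero[OF w this]
  have lim: "(\<lambda>i. wsum (w i) (\<lambda>j. norm (f j - l))) \<longlonglongrightarrow> 0" .
  have "norm (wsum (w i) f - l) \<le> wsum (w i) (\<lambda>j. norm (f j - l))" for i
    using norm_wsum_le[OF w, of i "\<lambda>j. f j - l"] wsum_const[OF w, of i l] by (simp add: wsum_diff)
  then have ev: "\<forall>\<^sub>F i in sequentially. norm (wsum (w i) f - l) \<le> wsum (w i) (\<lambda>j. norm (f j - l))"
    by simp
  have "(\<lambda>i. wsum (w i) f - l) \<longlonglongrightarrow> 0"
    by (rule Lim_null_comparison[OF ev lim])
  then show ?thesis by (simp add: LIM_zero_iff)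
qed

section \<open>Almost everywhere convergence of averages with nearly minimal norm\<close>

lemma parallelogram_midpoint:
  fixes a b :: "'b::real_inner"
  shows "(norm (a - b))\<^sup>2 = 2 * (norm a)\<^sup>2 + 2 * (norm b)\<^sup>2 - 4 * (norm ((1/2) *\<^sub>R (a + b)))\<^sup>2"
proof -
  have "(norm (a - b))\<^sup>2 = (norm a)\<^sup>2 + (norm b)\<^sup>2 - 2 * (a \<bullet> b)"
    by (simp add: power2_norm_eq_inner inner_diff_left inner_diff_right inner_commute)
  moreover have "(norm (a + b))\<^sup>2 = (norm a)\<^sup>2 + (norm b)\<^sup>2 + 2 * (a \<bullet> b)"
    by (simp add: power2_norm_eq_inner inner_add_left inner_add_right inner_commute)
  moreover have "(norm ((1/2) *\<^sub>R (a + b)))\<^sup>2 = (norm (a + b))\<^sup>2 / 4"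
    by (simp add: power_divide)
  ultimately show ?thesis by linarith
qed

text \<open>Exchanging sum and integral shows that the total variation of the sequence has finite
  integral, so at almost every point the increments are absolutely summable and telescoping gives
  convergence.\<close>

lemma ae_convergent_if_summable_L1:
  fixes v :: "nat \<Rightarrow> 'a \<Rightarrow> 'b::banach"
  assumes int: "\<And>k. integrable M (\<lambda>x. norm (v (Suc k) x - v k x))"
    and sm: "summable (\<lambda>k. \<integral>x. norm (v (Suc k) x - v k x) \<partial>M)"
  shows "AE x in M. convergent (\<lambda>k. v k x)"
proof -
  have meas[measurable]: "(\<lambda>x. norm (v (Suc k) x - v k x)) \<in> borel_measurable M" for k
    using int by auto
  have "(\<integral>\<^sup>+ x. (\<Sum>k. ennreal (norm (v (Suc k) x - v k x))) \<partial>M)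
      = (\<Sum>k. \<integral>\<^sup>+ x. ennreal (norm (v (Suc k) x - v k x)) \<partial>M)"
    by (rule nn_integral_suminf) auto
  also have "\<dots> = (\<Sum>k. ennreal (\<integral>x. norm (v (Suc k) x - v k x) \<partial>M))"
    by (intro arg_cong[where f=suminf] ext nn_integral_eq_integral int) auto
  also have "\<dots> \<noteq> \<infinity>"
    using sm by (simp add: suminf_ennreal2)
  finally have "AE x in M. (\<Sum>k. ennreal (norm (v (Suc k) x - v k x))) \<noteq> \<infinity>"
    by (intro nn_integral_PInf_AE) auto
  then show ?thesis
  proof eventually_elim
    case (elim x)
    then have "summable (\<lambda>k. norm (v (Suc k) x - v k x))"
      by (intro summable_suminf_not_top) auto
    then have "summable (\<lambda>k. v (Suc k) x - v k x)" by (rule summable_norm_cancel)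
    then obtain s where "(\<lambda>n. \<Sum>k<n. v (Suc k) x - v k x) \<longlonglongrightarrow> s"
      by (auto simp: summable_def sums_def)
    then have "(\<lambda>n. (v n x - v 0 x) + v 0 x) \<longlonglongrightarrow> s + v 0 x"
      by (intro tendsto_add tendsto_const) (simp add: sum_lessThan_telescope[of "\<lambda>k. v k x"])
    then show ?case by (auto simp: convergent_def)
  qed
qed

text \<open>The infima \<open>d i\<close> of the squared L2 norm over tail averages increase with
  \<open>i\<close> and are bounded; \<open>D\<close> is their limit. If two averages have squared
  norms near \<open>D\<close> and their midpoint lies in a tail whose infimum is near
  \<open>D\<close>, the parallelogram law forces them to be close.\<close>

lemma ae_convergent_tail_averages:
  fixes u :: "nat \<Rightarrow> 'a \<Rightarrow> 'b::euclidean_space"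
  assumes "finite_measure M" and u[measurable]: "\<And>j. u j \<in> borel_measurable M"
    and B: "\<And>j x. x \<in> space M \<Longrightarrow> norm (u j x) \<le> B"
  obtains w where "\<And>i. w i \<in> tail_weights i"
    "AE x in M. convergent (\<lambda>i. wsum (w i) (\<lambda>j. u j x))"
proof -
  interpret finite_measure M by fact
  define v where "v p x = wsum p (\<lambda>j. u j x)" for p x
  define E where "E p = (\<integral>x. (norm (v p x))\<^sup>2 \<partial>M)" for p
  define d where "d i = Inf (E ` tail_weights i)" for i
  have vm[measurable]: "v p \<in> borel_measurable M" for p
    unfolding v_def wsum_def by measurable
  have vB: "norm (v p x) \<le> B" if "p \<in> tail_weights i" "x \<in> space M" for p i x
    unfolding v_def by (intro norm_wsum_le_bound[OF that(1)] B[OF that(2)])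
  have vint: "integrable M (\<lambda>x. (norm (v p x))\<^sup>2)" if "p \<in> tail_weights i" for p i
    using vB[OF that] by (intro integrable_const_bound[where B="B\<^sup>2"]) (auto intro!: power_mono)
  have E0: "E p \<ge> 0" for p unfolding E_def by (simp add: integral_nonneg_AE)
  have EB: "E p \<le> B\<^sup>2 * measure M (space M)" if "p \<in> tail_weights i" for p i
  proof -
    have "E p \<le> (\<integral>x. B\<^sup>2 \<partial>M)"
      unfolding E_def by (rule integral_mono) (use vB[OF that] in \<open>auto intro!: power_mono vint[OF that]\<close>)
    then show ?thesis by (simp add: mult.commute)
  qed
  have bdd: "bdd_below (E ` tail_weights i)" for i using E0 by (auto intro!: bdd_belowI)
  have dle: "d i \<le> E p" if "p \<in> tail_weights i" for p i
    unfolding d_def by (rule cInf_lower) (use that bdd in auto)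
  have dmono: "d i \<le> d j" if "i \<le> j" for i j
    unfolding d_def by (rule cInf_superset_mono)
      (use tail_weights_nonempty tail_weights_mono[OF that] bdd in auto)
  have dB: "d i \<le> B\<^sup>2 * measure M (space M)" for i
    using tail_weights_nonempty[of i] dle EB by (metis ex_in_conv order_trans)
  define D where "D = (SUP i. d i)"
  have bdd': "bdd_above (range d)" using dB by (auto intro!: bdd_aboveI)
  have dD: "d i \<le> D" for i unfolding D_def by (rule cSUP_upper) (use bdd' in auto)
  \<comment> \<open>The tail \<open>m\<close> has to be late enough for \<open>d m\<close> to be
    near its supremum, and at least \<open>k\<close> so that the average also belongs to
    \<open>tail_weights k\<close>; \<open>p\<close> is then a near-minimizer of that tail.\<close>
  have ex: "\<exists>p m. k \<le> m \<and> p \<in> tail_weights m \<and> D - e < d m \<and> E p < D + e" if "e > 0" for k e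
  proof -
    have "D - e < D" using that by simp
    then obtain m0 where "D - e < d m0"
      unfolding D_def using less_cSUP_iff[OF _ bdd'] by blast
    then have m: "D - e < d (max k m0)" using dmono[of m0 "max k m0"] by auto
    have "d (max k m0) < D + e" using dD[of "max k m0"] that by auto
    then have "\<exists>p\<in>tail_weights (max k m0). E p < D + e"
      unfolding d_def using cInf_less_iff[OF _ bdd] tail_weights_nonempty by auto
    then show ?thesis using m by (metis max.cobounded1)
  qed
  \<comment> \<open>The rate 1/4 is dictated by \<open>L1\<close>: squared increments of order
    \<open>(1/4)^k\<close>, weighted with \<open>2^k\<close>, still leave the summable
    \<open>(1/2)^k\<close>.\<close>
  define \<epsilon> :: "nat \<Rightarrow> real" where "\<epsilon> k = (1/4)^k" for k
  have "\<forall>k. \<exists>p m. k \<le> m \<and> p \<in> tail_weights m \<and> D - \<epsilon> k < d m \<and> E p < D + \<epsilon> k"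
    using ex by (simp add: \<epsilon>_def)
  then obtain w m where wm: "\<And>k. k \<le> m k" "\<And>k. w k \<in> tail_weights (m k)"
      "\<And>k. D - \<epsilon> k < d (m k)" "\<And>k. E (w k) < D + \<epsilon> k" by metis
  have w: "w k \<in> tail_weights k" for k using wm(1,2) tail_weights_mono by blast
  have int2: "integrable M (\<lambda>x. (norm (v (w (Suc k)) x - v (w k) x))\<^sup>2)"
     and int1: "integrable M (\<lambda>x. norm (v (w (Suc k)) x - v (w k) x))" for k
  proof -
    have *: "norm (v (w (Suc k)) x - v (w k) x) \<le> 2 * B" if "x \<in> space M" for x
      using norm_triangle_ineq4[of "v (w (Suc k)) x" "v (w k) x"] vB[OF w that, of k] vB[OF w that, of "Suc k"] by linarith
    have **: "(norm (v (w (Suc k)) x - v (w k) x))\<^sup>2 \<le> (2*B)\<^sup>2" if "x \<in> space M" for x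
      by (rule power_mono[OF *[OF that]]) simp
    show "integrable M (\<lambda>x. (norm (v (w (Suc k)) x - v (w k) x))\<^sup>2)"
      by (rule integrable_const_bound[where B="(2*B)\<^sup>2"]) (rule AE_I2, simp only: real_norm_def abs_power2 **, measurable)
    show "integrable M (\<lambda>x. norm (v (w (Suc k)) x - v (w k) x))"
      by (rule integrable_const_bound[where B="2*B"]) (use * in auto)
  qed
  have L2: "(\<integral>x. (norm (v (w (Suc k)) x - v (w k) x))\<^sup>2 \<partial>M) \<le> 8 * \<epsilon> k" for k
  proof -
    \<comment> \<open>With the smaller index both averages and their midpoint lie in one tail whose
      infimum still exceeds \<open>D - \<epsilon> k\<close>. The parallelogram law then gives at
      most \<open>2 * (D + \<epsilon> k) + 2 * (D + \<epsilon> k) - 4 * (D - \<epsilon> k) = 8 *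
      \<epsilon> k\<close>.\<close>
    define n where "n = min (m k) (m (Suc k))"
    have "w k \<in> tail_weights n" "w (Suc k) \<in> tail_weights n"
      using wm(2)[of k] wm(2)[of "Suc k"] tail_weights_mono[of n "m k"] tail_weights_mono[of n "m (Suc k)"] by (auto simp: n_def)
    then obtain r where r: "r \<in> tail_weights n"
        "\<And>f :: nat \<Rightarrow> 'b. wsum r f = (1/2) *\<^sub>R (wsum (w (Suc k)) f + wsum (w k) f)"
      using tail_weights_midpoint by metis
    have \<epsilon>: "\<epsilon> (Suc k) \<le> \<epsilon> k" by (simp add: \<epsilon>_def)
    have "D - \<epsilon> k < d n" using wm(3)[of k] wm(3)[of "Suc k"] \<epsilon> by (auto simp: n_def min_def)
    then have "D - \<epsilon> k < E r" using dle[OF r(1)] by simp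
    moreover have "(\<integral>x. (norm (v (w (Suc k)) x - v (w k) x))\<^sup>2 \<partial>M) = 2 * E (w (Suc k)) + 2 * E (w k) - 4 * E r"
      unfolding parallelogram_midpoint[of "v (w (Suc k)) _"]
      using r(2)[of "\<lambda>j. u j _"] vint[OF w] vint[OF r(1)] unfolding E_def v_def
      by (simp add: Bochner_Integration.integral_diff Bochner_Integration.integral_add)
    ultimately show ?thesis using wm(4)[of k] wm(4)[of "Suc k"] \<epsilon> by linarith
  qed
  have L1: "(\<integral>x. norm (v (w (Suc k)) x - v (w k) x) \<partial>M) \<le> (measure M (space M) + 8) * (1/2)^k" for k
  proof -
    \<comment> \<open>Young's inequality with weight \<open>2^k\<close> takes the place of
      Cauchy-Schwarz in passing from the L2 to the L1 size of the increments.\<close>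
    have amgm: "a \<le> (1/2)^k + 2^k * a\<^sup>2" for a :: real
    proof -
      have "0 \<le> (2^k * a - 1)\<^sup>2" by simp
      then have "2 * (2^k * a) \<le> 2^k * (2^k * a\<^sup>2) + 1"
        by (simp add: power2_eq_square algebra_simps)
      then have "2^k * a \<le> 2^k * ((1/2)^k + 2^k * a\<^sup>2)"
      proof -
        have "(2::real)^k * (1/2)^k = 1" by (simp add: power_mult_distrib[symmetric])
        moreover have "2^k * (2^k * a\<^sup>2) \<ge> 0" by simp
        ultimately show ?thesis
          using \<open>2 * (2^k * a) \<le> 2^k * (2^k * a\<^sup>2) + 1\<close> unfolding distrib_left by linarith
      qed
      then show ?thesis by simp
    qed
    have "(\<integral>x. norm (v (w (Suc k)) x - v (w k) x) \<partial>M)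
        \<le> (\<integral>x. (1/2)^k + 2^k * (norm (v (w (Suc k)) x - v (w k) x))\<^sup>2 \<partial>M)"
      by (rule integral_mono) (use int1 int2 amgm in auto)
    also have "\<dots> = (1/2)^k * measure M (space M) + 2^k * (\<integral>x. (norm (v (w (Suc k)) x - v (w k) x))\<^sup>2 \<partial>M)"
      using int2 by simp
    also have "\<dots> \<le> (1/2)^k * measure M (space M) + 2^k * (8 * \<epsilon> k)"
      using L2 by (intro add_left_mono mult_left_mono) auto
    also have "2^k * (8 * \<epsilon> k) = 8 * (1/2)^k"
      by (simp add: \<epsilon>_def power_mult_distrib[symmetric] mult.assoc mult.left_commute)
    finally show ?thesis by (simp add: algebra_simps)
  qed
  have "summable (\<lambda>k. \<integral>x. norm (v (w (Suc k)) x - v (w k) x) \<partial>M)"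
  proof (rule summable_comparison_test)
    show "summable (\<lambda>k. (measure M (space M) + 8) * (1/2::real)^k)"
      by (intro summable_mult summable_geometric) auto
    show "\<exists>N. \<forall>k\<ge>N. norm (\<integral>x. norm (v (w (Suc k)) x - v (w k) x) \<partial>M) \<le> (measure M (space M) + 8) * (1/2)^k"
      using L1 by (simp add: integral_nonneg_AE)
  qed
  then have "AE x in M. convergent (\<lambda>k. v (w k) x)"
    using int1 by (intro ae_convergent_if_summable_L1)
  then show thesis using that w unfolding v_def by blast
qed

section \<open>Lebesgue differentiation and the fundamental theorem for Lipschitz functions\<close>

text \<open>The limit \<open>l\<close> is supplied from outside: in the applications the integrals
  of the \<open>f k\<close> are known explicitly, and their limit identifies the integral of
  \<open>g\<close>.\<close>

lemma has_integral_dominated_convergence_negligible: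
  fixes f :: "nat \<Rightarrow> 'n::euclidean_space \<Rightarrow> 'm::euclidean_space"
  assumes f: "\<And>k. (f k has_integral y k) S" and h: "h integrable_on S" and N: "negligible N"
    and le: "\<And>k x. x \<in> S - N \<Longrightarrow> norm (f k x) \<le> h x"
    and lim: "\<And>x. x \<in> S - N \<Longrightarrow> (\<lambda>k. f k x) \<longlonglongrightarrow> g x"
    and y: "y \<longlonglongrightarrow> l"
  shows "(g has_integral l) S"
proof -
  define r where "r F = (\<lambda>x. if x \<in> N then 0 else F x)" for F :: "'n \<Rightarrow> 'm"
  have "(r g has_integral l) S"
  proof (rule has_integral_dominated_convergence)
    show "(r (f k) has_integral y k) S" for k
      by (rule has_integral_spike[OF N _ f]) (auto simp: r_def)
    show "(\<lambda>x. if x \<in> N then 0 else h x) integrable_on S"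
      by (rule integrable_spike[OF h N]) auto
    show "\<forall>x\<in>S. norm (r (f k) x) \<le> (if x \<in> N then 0 else h x)" for k
      using le by (auto simp: r_def)
    show "\<forall>x\<in>S. (\<lambda>k. r (f k) x) \<longlonglongrightarrow> r g x"
      using lim by (auto simp: r_def)
  qed (rule y)
  then show ?thesis
    by (rule has_integral_spike[OF N, rotated]) (auto simp: r_def)
qed

lemma AE_lebesgue_on_negligible:
  assumes "S \<in> sets lebesgue"
  shows "(AE t in lebesgue_on S. P t) \<longleftrightarrow> (\<exists>N. negligible N \<and> (\<forall>t\<in>S - N. P t))"
  using assms by (auto simp: AE_restrict_space_iff eventually_ae_filter_negligible)

lemma has_vector_derivative_forward_sequence:
  fixes f :: "real \<Rightarrow> 'a::real_normed_vector"
  assumes "(f has_vector_derivative d) (at t)"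
  shows "(\<lambda>n. real (Suc n) *\<^sub>R (f (t + inverse (real (Suc n))) - f t)) \<longlonglongrightarrow> d"
proof -
  have "((\<lambda>h. norm (f (t + h) - f t - h *\<^sub>R d) / norm h) \<longlongrightarrow> 0) (at 0)"
    using assms by (simp add: has_vector_derivative_def has_derivative_at)
  moreover have "filterlim (\<lambda>n. inverse (real (Suc n))) (at 0) sequentially"
    using LIMSEQ_inverse_real_of_nat by (auto simp: filterlim_at)
  ultimately have "(\<lambda>n. norm (f (t + inverse (real (Suc n))) - f t - inverse (real (Suc n)) *\<^sub>R d) / norm (inverse (real (Suc n)))) \<longlonglongrightarrow> 0"
    by (rule filterlim_compose)
  moreover have "norm (f (t + inverse (real (Suc n))) - f t - inverse (real (Suc n)) *\<^sub>R d) / norm (inverse (real (Suc n)))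
      = norm (real (Suc n) *\<^sub>R (f (t + inverse (real (Suc n))) - f t) - d)" for n
  proof -
    have "real (Suc n) *\<^sub>R (f (t + inverse (real (Suc n))) - f t) - d
        = real (Suc n) *\<^sub>R (f (t + inverse (real (Suc n))) - f t - inverse (real (Suc n)) *\<^sub>R d)"
      by (simp add: scaleR_diff_right del: of_nat_Suc)
    then show ?thesis
      by (simp add: divide_inverse mult.commute del: of_nat_Suc)
  qed
  ultimately have "(\<lambda>n. norm (real (Suc n) *\<^sub>R (f (t + inverse (real (Suc n))) - f t) - d)) \<longlonglongrightarrow> 0"
    by (simp only:)
  then show ?thesis by (simp add: tendsto_norm_zero_iff LIM_zero_iff del: of_nat_Suc)
qed

text \<open>Integrating the difference quotients of a Lipschitz function gives difference quotients of
  its primitive, so dominated convergence replaces the theory of absolutely continuous functions.\<close>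

lemma lipschitz_on_has_integral_derivative:
  fixes x :: "real \<Rightarrow> 'a::euclidean_space"
  assumes ab: "a \<le> b" and lip: "L-lipschitz_on {a..b} x"
    and der: "AE t in lebesgue_on {a<..<b}. (x has_vector_derivative g t) (at t)"
  shows "(g has_integral (x b - x a)) {a..b}"
proof -
  obtain N where N: "negligible N" "\<And>t. t \<in> {a<..<b} - N \<Longrightarrow> (x has_vector_derivative g t) (at t)"
    using der by (subst (asm) AE_lebesgue_on_negligible) auto
  \<comment> \<open>Constant continuation beyond both endpoints keeps forward quotients near
    \<open>b\<close> defined; clamping does not increase distances, so the constant \<open>L\<close>
    is kept.\<close>
  define y where "y t = x (max a (min b t))" for t
  have ylip: "norm (y s - y t) \<le> L * \<bar>s - t\<bar>" for s t
  proof -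
    have "dist (y s) (y t) \<le> L * dist (max a (min b s)) (max a (min b t))"
      unfolding y_def using ab by (intro lipschitz_onD[OF lip]) auto
    also have "\<dots> \<le> L * \<bar>s - t\<bar>"
      using lipschitz_on_nonneg[OF lip] by (intro mult_left_mono) (auto simp: dist_real_def)
    finally show ?thesis by (simp add: dist_norm)
  qed
  have "L-lipschitz_on UNIV y"
    using ylip lipschitz_on_nonneg[OF lip] by (intro lipschitz_onI) (auto simp: dist_norm)
  then have ycont: "continuous_on A y" for A
    using lipschitz_on_continuous_on continuous_on_subset by blast
  \<comment> \<open>Starting the primitive at \<open>a - 1\<close> makes every point of
    \<open>{a..b + 1}\<close> interior, so two-sided derivatives hold there.\<close>
  define Y where "Y t = integral {a - 1..t} y" for t
  have Y: "(Y has_vector_derivative y t) (at t)" if "t \<in> {a..b + 1}" for t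
  proof -
    have "(Y has_vector_derivative y t) (at t within {a - 1..b + 2})"
      unfolding Y_def using that by (intro integral_has_vector_derivative ycont) auto
    then show ?thesis using that by (simp add: at_within_Icc_at)
  qed
  define q where "q F t n = real (Suc n) *\<^sub>R (F (t + inverse (real (Suc n))) - F t)" for F :: "real \<Rightarrow> 'a" and t n
  show ?thesis
  proof (rule has_integral_dominated_convergence_negligible[where f="\<lambda>n t. q y t n" and h="\<lambda>_. L"])
    show "((\<lambda>t. q y t n) has_integral (q Y b n - q Y a n)) {a..b}" for n
    proof (rule fundamental_theorem_of_calculus[OF ab])
      fix t assume t: "t \<in> {a..b}"
      define h where "h = inverse (real (Suc n))"
      have "0 < h" "h \<le> 1" unfolding h_def by (simp_all add: inverse_le_1_iff)
      then have "(Y has_vector_derivative y (t + h)) (at (t + h))"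
        using t by (intro Y) auto
      moreover have "((\<lambda>s. s + h) has_vector_derivative 1) (at t)"
        by (auto intro!: derivative_eq_intros)
      ultimately have "((\<lambda>s. Y (s + h)) has_vector_derivative y (t + h)) (at t)"
        using vector_diff_chain_at[of "\<lambda>s. s + h" 1 t Y] by (simp add: o_def)
      then show "((\<lambda>t. q Y t n) has_vector_derivative q y t n) (at t within {a..b})"
        unfolding q_def h_def using t
        by (intro has_vector_derivative_at_within[where S="{a..b}"] bounded_linear.has_vector_derivative[OF bounded_linear_scaleR_right]
            has_vector_derivative_diff Y) auto
    qed
    show "negligible (N \<union> {a, b})" using N by (simp add: negligible_Un)
    show "norm (q y t n) \<le> L" for t n
    proof -
      have "norm (q y t n) \<le> real (Suc n) * (L * \<bar>(t + inverse (real (Suc n))) - t\<bar>)"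
        unfolding q_def norm_scaleR abs_of_nat by (intro mult_left_mono ylip) auto
      also have "\<dots> = L" by (simp add: field_simps del: of_nat_Suc)
      finally show ?thesis .
    qed
    show "(\<lambda>n. q y t n) \<longlonglongrightarrow> g t" if t: "t \<in> {a..b} - (N \<union> {a, b})" for t
    proof -
      have "(x has_vector_derivative g t) (at t)" using N t by auto
      then have "(y has_vector_derivative g t) (at t)"
        by (rule has_vector_derivative_transform_within_open[of _ _ _ "{a<..<b}"]) (use t in \<open>auto simp: y_def\<close>)
      then show ?thesis unfolding q_def by (rule has_vector_derivative_forward_sequence)
    qed
    have "(\<lambda>n. q Y b n - q Y a n) \<longlonglongrightarrow> y b - y a"
      unfolding q_def using ab by (intro tendsto_diff has_vector_derivative_forward_sequence Y) auto
    then show "(\<lambda>n. q Y b n - q Y a n) \<longlonglongrightarrow> x b - x a"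
      using ab by (simp add: y_def)
  qed (rule integrable_const_ivl)
qed

text \<open>Forward averages of \<open>F\<close> give the right derivative, and forward averages of
  the reflected function give the left one. Outside the union of the two null sets both equal
  \<open>f t\<close>.\<close>

lemma AE_has_vector_derivative_integral:
  fixes f :: "real \<Rightarrow> 'b::euclidean_space"
  assumes f: "f integrable_on {a..b}"
  shows "AE t in lebesgue_on {a<..<b}. ((\<lambda>s. integral {a..s} f) has_vector_derivative f t) (at t)"
proof -
  \<comment> \<open>Extension by zero makes the function integrable on every interval, as the
    differentiation theorem on the whole line requires.\<close>
  define F where "F t = (if t \<in> {a..b} then f t else 0)" for t
  have "F integrable_on UNIV" using f unfolding F_def integrable_restrict_UNIV .
  then have F: "F integrable_on {c..d}" for c d
    using integrable_on_subcbox[of F UNIV c d] by auto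
  then have F': "(\<lambda>t. F (- t)) integrable_on {c..d}" for c d
    using Henstock_Kurzweil_Integration.integrable_reflect_real[where f=F and a="- d" and b="- c"] by simp
  obtain N1 where N1: "negligible N1" "\<And>t e. t \<notin> N1 \<Longrightarrow> 0 < e \<Longrightarrow>
      \<exists>d>0. \<forall>h. 0 < h \<and> h < d \<longrightarrow> norm (integral {t..t+h} F /\<^sub>R h - F t) < e"
    by (rule integrable_ccontinuous_explicit[of F]) (use F in auto)
  obtain N2 where N2: "negligible N2" "\<And>t e. t \<notin> N2 \<Longrightarrow> 0 < e \<Longrightarrow>
      \<exists>d>0. \<forall>h. 0 < h \<and> h < d \<longrightarrow> norm (integral {t..t+h} (\<lambda>t. F (- t)) /\<^sub>R h - F (- t)) < e"
    by (rule integrable_ccontinuous_explicit[of "\<lambda>t. F (- t)"]) (use F' in auto)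
  have "negligible (uminus ` N2)"
    by (rule negligible_differentiable_image_negligible[OF _ N2(1)]) (auto intro!: derivative_intros)
  then have N: "negligible (N1 \<union> uminus ` N2)" using N1 by simp
  have "((\<lambda>s. integral {a..s} f) has_vector_derivative f t) (at t)"
    if t: "t \<in> {a<..<b} - (N1 \<union> uminus ` N2)" for t
    unfolding has_vector_derivative_def has_derivative_at_alt
  proof (intro conjI allI impI bounded_linear_scaleR_left)
    fix e :: real assume "e > 0"
    have "- t \<notin> N2" using t by force
    then obtain d2 where d2: "d2 > 0" "\<And>h. 0 < h \<Longrightarrow> h < d2 \<Longrightarrow> norm (integral {- t..- t+h} (\<lambda>t. F (- t)) /\<^sub>R h - F t) < e"
      using N2(2)[of "- t" e] \<open>e > 0\<close> by auto
    obtain d1 where d1: "d1 > 0" "\<And>h. 0 < h \<Longrightarrow> h < d1 \<Longrightarrow> norm (integral {t..t+h} F /\<^sub>R h - F t) < e"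
      using N1(2)[of t e] \<open>e > 0\<close> t by auto
    \<comment> \<open>Increments below \<open>d\<close> also keep \<open>s\<close> inside
      \<open>[a, b]\<close>, where \<open>F\<close> and \<open>f\<close> have the same
      integrals.\<close>
    define d where "d = min (min d1 d2) (min (t - a) (b - t))"
    have scale: "norm (X - h *\<^sub>R F t) \<le> e * h" if "norm (X /\<^sub>R h - F t) < e" "h > 0" for X h
    proof -
      have "X - h *\<^sub>R F t = h *\<^sub>R (X /\<^sub>R h - F t)" using that by (simp add: scaleR_diff_right)
      then have "norm (X - h *\<^sub>R F t) = h * norm (X /\<^sub>R h - F t)" using that by simp
      also have "\<dots> \<le> h * e" using that by (intro mult_left_mono) auto
      finally show ?thesis by (simp add: mult.commute)
    qed
    have eqF: "integral {c..d} F = integral {c..d} f" if "a \<le> c" "d \<le> b" for c d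
      using that by (intro integral_cong) (auto simp: F_def)
    have fsub: "f integrable_on {c..d}" if "a \<le> c" "d \<le> b" for c d
      using integrable_on_subinterval[OF f] that by auto
    have Ft: "F t = f t" using t by (simp add: F_def)
    have "norm (integral {a..s} f - integral {a..t} f - (s - t) *\<^sub>R f t) \<le> e * norm (s - t)"
      if s: "norm (s - t) < d" for s
    proof (rule linorder_cases[of s t])
      assume "s = t" then show ?thesis by simp
    next
      assume st: "t < s"
      have "integral {a..t} f + integral {t..s} f = integral {a..s} f"
        using t s st by (intro Henstock_Kurzweil_Integration.integral_combine fsub) (auto simp: d_def)
      then have "integral {a..s} f - integral {a..t} f = integral {t..s} f" by (simp add: algebra_simps)
      moreover have "norm (integral {t..s} F - (s - t) *\<^sub>R F t) \<le> e * (s - t)"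
        using d1(2)[of "s - t"] s st by (intro scale) (auto simp: d_def)
      moreover have "integral {t..s} F = integral {t..s} f"
        using t s st by (intro eqF) (auto simp: d_def)
      ultimately show ?thesis using st Ft by simp
    next
      assume st: "s < t"
      have "integral {a..s} f + integral {s..t} f = integral {a..t} f"
        using t s st by (intro Henstock_Kurzweil_Integration.integral_combine fsub) (auto simp: d_def)
      then have 1: "integral {a..s} f - integral {a..t} f = - integral {s..t} f" by (simp add: algebra_simps)
      have "integral {- t..- t + (t - s)} (\<lambda>t. F (- t)) = integral {s..t} F"
        using Henstock_Kurzweil_Integration.integral_reflect_real[where f=F and a=s and b=t] by simp
      then have "norm (integral {s..t} F - (t - s) *\<^sub>R F t) \<le> e * (t - s)"
        using d2(2)[of "t - s"] s st by (intro scale) (auto simp: d_def)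
      moreover have "integral {s..t} F = integral {s..t} f"
        using t s st by (intro eqF) (auto simp: d_def)
      moreover have "integral {a..s} f - integral {a..t} f - (s - t) *\<^sub>R f t = - (integral {s..t} f - (t - s) *\<^sub>R f t)"
        unfolding 1 by (simp add: algebra_simps)
      ultimately show ?thesis using st Ft by (simp only: norm_minus_cancel) simp
    qed
    then show "\<exists>d>0. \<forall>s. norm (s - t) < d \<longrightarrow>
        norm (integral {a..s} f - integral {a..t} f - (s - t) *\<^sub>R f t) \<le> e * norm (s - t)"
      using t d1(1) d2(1) by (intro exI[of _ d]) (auto simp: d_def)
  qed
  then show ?thesis
    using N by (intro AE_lebesgue_on_negligible[THEN iffD2] exI[of _ "N1 \<union> uminus ` N2"] conjI ballI) auto
qed

section \<open>The regularized delay operator\<close>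

lemma integral_exp_pos:
  fixes g :: "real \<Rightarrow> real"
  assumes "a < b" "continuous_on {a..b} g"
  shows "0 < integral {a..b} (\<lambda>s. exp (g s))"
proof -
  have "continuous_on {a..b} (\<lambda>s. exp (g s))" by (intro continuous_intros assms)
  from continuous_attains_inf[OF compact_Icc _ this] assms(1)
  obtain m where m: "m \<in> {a..b}" "\<And>s. s \<in> {a..b} \<Longrightarrow> exp (g m) \<le> exp (g s)" by auto
  have "0 < integral {a..b} (\<lambda>s. exp (g m))" using assms by simp
  also have "\<dots> \<le> integral {a..b} (\<lambda>s. exp (g s))"
    using assms m by (intro integral_le integrable_continuous_interval continuous_intros) auto
  finally show ?thesis .
qed

text \<open>The regularized maximum is monotone in the path and commutes with adding constants: a
  shift by \<open>c\<close> multiplies the integral by \<open>exp (k * c)\<close>, which contributes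
  exactly \<open>c\<close> after \<open>(1 / k) * ln\<close>. Hence the Lipschitz constant 1 per
  component, whatever \<open>k\<close> is.\<close>

lemma LIE_le:
  fixes x y :: "real \<Rightarrow> real^'n"
  assumes "k > 0" "tau > 0" and x: "continuous_on {t - tau..t} x" and y: "continuous_on {t - tau..t} y"
    and le: "\<And>s. s \<in> {t - tau..t} \<Longrightarrow> norm (x s - y s) \<le> c"
  shows "LIE k tau x t $ i \<le> LIE k tau y t $ i + c"
proof -
  let ?I = "\<lambda>z. integral {t - tau..t} (\<lambda>s. exp (k * z s $ i))"
  have pos: "?I x > 0" "?I y > 0"
    using assms by (auto intro!: integral_exp_pos continuous_intros)
  have "?I x \<le> integral {t - tau..t} (\<lambda>s. exp (k * c) * exp (k * y s $ i))"
  proof (intro integral_le integrable_continuous_interval continuous_intros x y)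
    fix s assume "s \<in> {t - tau..t}"
    then have "x s $ i - y s $ i \<le> c"
      using le[of s] component_le_norm_cart[of "x s - y s" i] by simp
    then have "x s $ i \<le> c + y s $ i" by simp
    from mult_left_mono[OF this, of k] \<open>k > 0\<close> have "k * x s $ i \<le> k * c + k * y s $ i"
      by (simp add: distrib_left)
    then show "exp (k * x s $ i) \<le> exp (k * c) * exp (k * y s $ i)" by (simp flip: exp_add)
  qed
  also have "\<dots> = exp (k * c) * ?I y" by simp
  finally have "ln (?I x) \<le> ln (exp (k * c) * ?I y)" using pos by simp
  also have "\<dots> = k * c + ln (?I y)" using pos by (simp add: ln_mult)
  finally show ?thesis using \<open>k > 0\<close> by (simp add: LIE_def field_simps)
qed

text \<open>The factor \<open>CARD('n)\<close> is the price of estimating the norm by the sum of the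
  components.\<close>

lemma norm_LIE_diff_le:
  fixes x y :: "real \<Rightarrow> real^'n"
  assumes "k > 0" "tau > 0" "continuous_on {t - tau..t} x" "continuous_on {t - tau..t} y"
    and le: "\<And>s. s \<in> {t - tau..t} \<Longrightarrow> norm (x s - y s) \<le> c"
  shows "norm (LIE k tau x t - LIE k tau y t) \<le> real CARD('n) * c"
proof -
  have "\<bar>(LIE k tau x t - LIE k tau y t) $ i\<bar> \<le> c" for i
    using LIE_le[OF assms, of i] LIE_le[of k tau t y x c i] assms by (simp add: norm_minus_commute abs_le_iff)
  then have "(\<Sum>i\<in>UNIV. \<bar>(LIE k tau x t - LIE k tau y t) $ i\<bar>) \<le> of_nat CARD('n) * c"
    by (intro sum_bounded_above) auto
  then show ?thesis using norm_le_l1_cart order_trans by blast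
qed

text \<open>The sliding integral is a difference of two values of one primitive, so both moving
  limits are handled by composition.\<close>

lemma continuous_on_sliding_integral:
  fixes g :: "real \<Rightarrow> 'a::banach"
  assumes "0 \<le> tau" and g: "continuous_on {-tau..T} g"
  shows "continuous_on {0..T} (\<lambda>t. integral {t - tau..t} g)"
proof -
  let ?G = "\<lambda>t. integral {-tau..t} g"
  have int: "g integrable_on {-tau..T}" using g by (rule integrable_continuous_interval)
  have G: "continuous_on {-tau..T} ?G" using int by (rule indefinite_integral_continuous_1)
  have "continuous_on {0..T} (\<lambda>t. ?G t - ?G (t - tau))"
    using assms(1)
    by (intro continuous_on_diff continuous_on_compose2[OF G] continuous_intros) auto
  moreover have "?G t - ?G (t - tau) = integral {t - tau..t} g" if "t \<in> {0..T}" for t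
    using that assms(1) Henstock_Kurzweil_Integration.integral_combine[of "-tau" "t - tau" t g] integrable_on_subinterval[OF int, of "-tau" t]
    by (auto simp: algebra_simps)
  ultimately show ?thesis by (rule continuous_on_eq)
qed

lemma continuous_on_LIE:
  assumes "tau > 0" and x: "continuous_on {-tau..T} x"
  shows "continuous_on {0..T} (LIE k tau x)"
proof -
  have "continuous_on {0..T} (\<lambda>t. (1/k) * ln (integral {t - tau..t} (\<lambda>s. exp (k * x s $ i))))" for i
  proof (intro continuous_intros continuous_on_sliding_integral x ballI)
    fix t assume "t \<in> {0..T}"
    then have "0 < integral {t - tau..t} (\<lambda>s. exp (k * x s $ i))"
      using assms by (intro integral_exp_pos continuous_intros continuous_on_subset[OF x]) auto
    then show "integral {t - tau..t} (\<lambda>s. exp (k * x s $ i)) \<noteq> 0" by simp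
  qed (use assms in auto)
  then show ?thesis unfolding LIE_def by (intro continuous_on_vec_lambda)
qed

lemma bounded_bilinear_matrix_vector_mult:
  "bounded_bilinear ((*v) :: real^'m^'n \<Rightarrow> real^'m \<Rightarrow> real^'n)"
proof
  show "\<exists>K. \<forall>A x. norm ((A :: real^'m^'n) *v x) \<le> norm A * norm x * K"
  proof (intro exI allI)
    fix A :: "real^'m^'n" and x :: "real^'m"
    have "\<bar>(A *v x) $ i\<bar> \<le> norm A * norm x" for i
    proof -
      have "\<bar>(A *v x) $ i\<bar> \<le> norm (A $ i) * norm x"
        unfolding matrix_vector_mul_component by (rule Cauchy_Schwarz_ineq2)
      also have "\<dots> \<le> norm A * norm x"
        using Finite_Cartesian_Product.norm_nth_le[of A i] by (intro mult_right_mono) auto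
      finally show ?thesis .
    qed
    then have "(\<Sum>i\<in>UNIV. \<bar>(A *v x) $ i\<bar>) \<le> of_nat CARD('n) * (norm A * norm x)"
      by (intro sum_bounded_above) auto
    then show "norm (A *v x) \<le> norm A * norm x * real CARD('n)"
      using norm_le_l1_cart[of "A *v x"] by (simp add: mult.commute)
  qed
qed (simp_all add: matrix_vector_mult_add_rdistrib matrix_vector_right_distrib
      vector_scalar_commute scaleR_matrix_vector_assoc matrix_vector_mult_scaleR)

section \<open>Delay equations with admissible controls\<close>

text \<open>The regularized delay enters only through continuity in time and a Lipschitz bound by
  the sup distance over \<open>{t - tau..t}\<close>, which also encodes causality. The bound in
  \<open>f_lipschitz\<close> is restricted to \<open>U\<close> because the state-Lipschitz constant
  of a control-affine field may grow with the control. \<open>f_affine\<close> expresses affinity as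
  linearity after subtracting the value at 0.\<close>

locale delay_control =
  fixes f :: "'a::euclidean_space \<Rightarrow> 'a \<Rightarrow> 'b::euclidean_space \<Rightarrow> 'a"
    and D :: "(real \<Rightarrow> 'a) \<Rightarrow> real \<Rightarrow> 'a" and tau T :: real and phi :: "real \<Rightarrow> 'a"
    and U :: "'b set" and Kf KD :: real
  assumes T_pos: "0 < T" and tau_pos: "0 < tau"
    and phi_continuous: "continuous_on {-tau..0} phi"
    and U_compact: "compact U"
    and f_continuous: "continuous_on UNIV (\<lambda>(x, v, u). f x v u)"
    and Kf_nonneg: "0 \<le> Kf"
    and f_lipschitz: "\<And>x v y w u. u \<in> U \<Longrightarrow> norm (f x v u - f y w u) \<le> Kf * (norm (x - y) + norm (v - w))"
    and f_affine: "\<And>x v. linear (\<lambda>u. f x v u - f x v 0)"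
    and D_continuous: "\<And>x. continuous_on {-tau..T} x \<Longrightarrow> continuous_on {0..T} (D x)"
    and KD_nonneg: "0 \<le> KD"
    and D_lipschitz: "\<And>x y t c. continuous_on {-tau..T} x \<Longrightarrow> continuous_on {-tau..T} y \<Longrightarrow> t \<in> {0..T}
      \<Longrightarrow> (\<And>s. s \<in> {t - tau..t} \<Longrightarrow> norm (x s - y s) \<le> c) \<Longrightarrow> norm (D x t - D y t) \<le> KD * c"
begin

text \<open>Membership in \<open>U\<close> is demanded at every time, so pointwise estimates carry
  no exceptional sets; \<open>feasible_representative\<close> makes the passage from almost
  everywhere membership.\<close>

definition admissible :: "(real \<Rightarrow> 'b) \<Rightarrow> bool" where
  "admissible u \<longleftrightarrow> u \<in> borel_measurable (lebesgue_on {0..T}) \<and> (\<forall>t\<in>{0..T}. u t \<in> U)"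

definition history_path :: "(real \<Rightarrow> 'a) \<Rightarrow> bool" where
  "history_path x \<longleftrightarrow> continuous_on {-tau..T} x \<and> (\<forall>s\<in>{-tau..0}. x s = phi s)"

definition velocity :: "(real \<Rightarrow> 'a) \<Rightarrow> (real \<Rightarrow> 'b) \<Rightarrow> real \<Rightarrow> 'a" where
  "velocity x u t = f (x t) (D x t) (u t)"

text \<open>The Volterra form survives averaging and uniform limits, whereas derivatives of the
  states need not converge. \<open>integral_solution_iff\<close> gives the equivalence with the
  differential form.\<close>

definition integral_solution :: "(real \<Rightarrow> 'b) \<Rightarrow> (real \<Rightarrow> 'a) \<Rightarrow> bool" where
  "integral_solution u x \<longleftrightarrow> history_path x \<and>
     (\<forall>t\<in>{0..T}. (velocity x u has_integral (x t - phi 0)) {0..t})"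

text \<open>Start of the Picard iteration and common reference path for the a priori bounds.\<close>

definition constant_extension :: "real \<Rightarrow> 'a" where
  "constant_extension t = phi (min t 0)"

text \<open>\<open>Kf * (1 + KD)\<close> is a Lipschitz constant of the velocity in the path, for
  the sup norm over the delay window; the added 1 keeps it strictly positive for divisions and
  exponential weights.\<close>

definition growth :: real where
  "growth = Kf * (1 + KD) + 1"

section \<open>Estimates for the velocity along a path\<close>

lemma growth_pos: "0 < growth"
  using Kf_nonneg KD_nonneg by (simp add: growth_def add_nonneg_pos)

lemma history_path_constant_extension: "history_path constant_extension"
proof -
  have "continuous_on {-tau..T} (\<lambda>t. phi (min t 0))"
    by (rule continuous_on_compose2[OF phi_continuous]) (use tau_pos in \<open>auto intro!: continuous_intros\<close>)
  then show ?thesis by (auto simp: history_path_def constant_extension_def[abs_def] min_def)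
qed

lemma velocity_measurable:
  assumes "history_path x" "u \<in> borel_measurable (lebesgue_on {0..T})"
  shows "velocity x u \<in> borel_measurable (lebesgue_on {0..T})"
proof -
  have x: "continuous_on {-tau..T} x" using assms by (simp add: history_path_def)
  have [measurable]: "x \<in> borel_measurable (lebesgue_on {0..T})" "D x \<in> borel_measurable (lebesgue_on {0..T})"
    using continuous_on_subset[OF x, of "{0..T}"] D_continuous[OF x] tau_pos
    by (auto intro!: continuous_imp_measurable_on_sets_lebesgue)
  note [measurable] = assms(2)
  have "(\<lambda>t. (x t, D x t, u t)) \<in> borel_measurable (lebesgue_on {0..T})"
    by (intro borel_measurable_Pair) measurable
  from measurable_compose[OF this borel_measurable_continuous_onI[OF f_continuous]]
  show ?thesis by (simp add: velocity_def[abs_def])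
qed

lemma velocity_diff_le:
  assumes "history_path x" "history_path y" "u \<in> U" "t \<in> {0..T}"
    and le: "\<And>s. s \<in> {t - tau..t} \<Longrightarrow> norm (x s - y s) \<le> c"
  shows "norm (f (x t) (D x t) u - f (y t) (D y t) u) \<le> growth * c"
proof -
  have "norm (x t - y t) \<le> c" using tau_pos by (intro le) auto
  moreover from this have "0 \<le> c" using norm_ge_zero order_trans by blast
  moreover have "norm (D x t - D y t) \<le> KD * c"
    using assms by (intro D_lipschitz) (auto simp: history_path_def)
  ultimately have "Kf * (norm (x t - y t) + norm (D x t - D y t)) \<le> Kf * (c + KD * c)"
    using Kf_nonneg by (intro mult_left_mono add_mono)
  also have "\<dots> \<le> growth * c" using \<open>0 \<le> c\<close> by (simp add: growth_def algebra_simps)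
  finally show ?thesis using f_lipschitz[OF assms(3)] order_trans by blast
qed

text \<open>Compactness of \<open>{0..T} \<times> U\<close> yields one bound for all control
  values.\<close>

lemma constant_extension_velocity_bound:
  obtains C where "0 \<le> C" "\<And>t u. t \<in> {0..T} \<Longrightarrow> u \<in> U \<Longrightarrow> norm (f (constant_extension t) (D constant_extension t) u) \<le> C"
proof -
  have p: "continuous_on {-tau..T} constant_extension" using history_path_constant_extension by (simp add: history_path_def)
  have "continuous_on ({0..T} \<times> U) (\<lambda>z. (\<lambda>(x, v, u). f x v u) (constant_extension (fst z), D constant_extension (fst z), snd z))"
    using tau_pos
    by (intro continuous_on_compose2[OF f_continuous] continuous_on_Pair continuous_on_compose2[OF p]
        continuous_on_compose2[OF D_continuous[OF p]] continuous_intros) auto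
  then have "compact ((\<lambda>z. f (constant_extension (fst z)) (D constant_extension (fst z)) (snd z)) ` ({0..T} \<times> U))"
    by (intro compact_continuous_image compact_Times U_compact) auto
  then have "bounded ((\<lambda>z. f (constant_extension (fst z)) (D constant_extension (fst z)) (snd z)) ` ({0..T} \<times> U))"
    by (rule compact_imp_bounded)
  then obtain C where C: "0 < C" "\<And>z. z \<in> {0..T} \<times> U \<Longrightarrow> norm (f (constant_extension (fst z)) (D constant_extension (fst z)) (snd z)) \<le> C"
    unfolding bounded_pos by auto
  show thesis
  proof (rule that)
    show "norm (f (constant_extension t) (D constant_extension t) u) \<le> C" if "t \<in> {0..T}" "u \<in> U" for t u
      using C(2)[of "(t, u)"] that by simp
  qed (use C in simp)
qed

text \<open>The bound for the reference path transfers to any other, since their velocities differ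
  by at most \<open>growth\<close> times the sup distance.\<close>

lemma velocity_bounded:
  assumes x: "history_path x"
  obtains B where "\<And>u t. t \<in> {0..T} \<Longrightarrow> u \<in> U \<Longrightarrow> norm (f (x t) (D x t) u) \<le> B"
proof -
  obtain C where C: "0 \<le> C" "\<And>t u. t \<in> {0..T} \<Longrightarrow> u \<in> U \<Longrightarrow> norm (f (constant_extension t) (D constant_extension t) u) \<le> C"
    using constant_extension_velocity_bound by blast
  have "compact ((\<lambda>t. x t - constant_extension t) ` {-tau..T})"
    using x history_path_constant_extension
    by (intro compact_continuous_image continuous_on_diff) (auto simp: history_path_def)
  then have "bounded ((\<lambda>t. x t - constant_extension t) ` {-tau..T})"
    by (rule compact_imp_bounded)
  then obtain c where c: "\<forall>t\<in>{-tau..T}. norm (x t - constant_extension t) \<le> c"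
    unfolding bounded_iff by auto
  show thesis
  proof (rule that)
    fix t u assume t: "t \<in> {0..T}" and u: "u \<in> U"
    have "norm (f (x t) (D x t) u - f (constant_extension t) (D constant_extension t) u) \<le> growth * c"
      using c t by (intro velocity_diff_le x history_path_constant_extension u) auto
    then show "norm (f (x t) (D x t) u) \<le> C + growth * c"
      using C(2)[OF t u] norm_triangle_sub[of "f (x t) (D x t) u" "f (constant_extension t) (D constant_extension t) u"] by linarith
  qed
qed

lemma velocity_integrable:
  assumes "history_path x" "admissible u" "0 \<le> s" "t \<le> T"
  shows "velocity x u integrable_on {s..t}"
proof -
  obtain B where B: "\<And>u t. t \<in> {0..T} \<Longrightarrow> u \<in> U \<Longrightarrow> norm (f (x t) (D x t) u) \<le> B"
    using velocity_bounded[OF assms(1)] by blast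
  have "velocity x u integrable_on {0..T}"
  proof (rule measurable_bounded_by_integrable_imp_integrable)
    show "velocity x u \<in> borel_measurable (lebesgue_on {0..T})"
      using assms by (intro velocity_measurable) (auto simp: admissible_def)
    show "norm (velocity x u t) \<le> B" if "t \<in> {0..T}" for t
      using B[of t "u t"] that assms(2) by (auto simp: velocity_def admissible_def)
  qed (auto intro: integrable_const_ivl)
  then show ?thesis by (rule integrable_on_subinterval) (use assms in auto)
qed

text \<open>With respect to the weight \<open>exp (2 * growth * t)\<close> the Picard operator is a contraction on the
  whole interval.\<close>

lemma velocity_integral_contraction:
  assumes x: "history_path x" and y: "history_path y" and u: "admissible u" and t: "t \<in> {0..T}"
    and A: "0 \<le> A" and le: "\<And>s. s \<in> {0..T} \<Longrightarrow> norm (x s - y s) \<le> A * exp (2 * growth * s)"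
  shows "norm (integral {0..t} (velocity x u) - integral {0..t} (velocity y u)) \<le> A / 2 * exp (2 * growth * t)"
proof -
  \<comment> \<open>The exponent \<open>2 * growth\<close> against the factor \<open>growth\<close>
    produces the contraction factor 1/2; the subtracted value at 0 is dropped at the end.\<close>
  have "((\<lambda>s. growth * (A * exp (2 * growth * s))) has_integral
      (A / 2 * exp (2 * growth * t) - A / 2 * exp (2 * growth * 0))) {0..t}"
    using t by (intro fundamental_theorem_of_calculus)
      (auto intro!: derivative_eq_intros simp flip: has_real_derivative_iff_has_vector_derivative)
  then have weight: "integral {0..t} (\<lambda>s. growth * (A * exp (2 * growth * s)))
      = A / 2 * exp (2 * growth * t) - A / 2 * exp (2 * growth * 0)"
    by (rule integral_unique)
  have "norm (integral {0..t} (\<lambda>s. velocity x u s - velocity y u s))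
      \<le> integral {0..t} (\<lambda>s. growth * (A * exp (2 * growth * s)))"
  proof (rule integral_norm_bound_integral)
    show "(\<lambda>s. velocity x u s - velocity y u s) integrable_on {0..t}"
      using t by (intro integrable_diff velocity_integrable x y u) auto
    show "(\<lambda>s. growth * (A * exp (2 * growth * s))) integrable_on {0..t}"
      by (intro integrable_continuous_interval continuous_intros)
    fix s assume s: "s \<in> {0..t}"
    \<comment> \<open>History times contribute nothing because both paths equal \<open>phi\<close>
      there; at the other times of the window the weight increases, so its value at \<open>s\<close>
      dominates.\<close>
    have "norm (x r - y r) \<le> A * exp (2 * growth * s)" if r: "r \<in> {s - tau..s}" for r
    proof (cases "r < 0")
      case True
      then have "x r = y r" using x y r s by (auto simp: history_path_def)
      then show ?thesis using A by simp
    next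
      case False
      then have "norm (x r - y r) \<le> A * exp (2 * growth * r)" using r s t by (intro le) auto
      also have "\<dots> \<le> A * exp (2 * growth * s)" using A r growth_pos by (intro mult_left_mono) auto
      finally show ?thesis .
    qed
    then show "norm (velocity x u s - velocity y u s) \<le> growth * (A * exp (2 * growth * s))"
      unfolding velocity_def using u s t by (intro velocity_diff_le x y) (auto simp: admissible_def)
  qed
  also have "\<dots> \<le> A / 2 * exp (2 * growth * t)" unfolding weight using A by simp
  finally show ?thesis
    using t by (subst integral_diff[symmetric]) (auto intro!: velocity_integrable x y u)
qed

lemma history_path_uniform_limit:
  assumes x: "\<And>n. history_path (x n)" and lim: "uniform_limit {-tau..T} x y sequentially"
  shows "history_path y"
proof -
  have "continuous_on {-tau..T} y"
    by (rule uniform_limit_theorem[OF _ lim]) (use x in \<open>auto simp: history_path_def\<close>)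
  moreover have "y s = phi s" if "s \<in> {-tau..0}" for s
  proof -
    have "(\<lambda>n. x n s) \<longlonglongrightarrow> y s" using lim by (rule tendsto_uniform_limitI) (use that T_pos in auto)
    moreover have "x n s = phi s" for n using x that by (auto simp: history_path_def)
    ultimately show ?thesis by (simp add: LIMSEQ_const_iff)
  qed
  ultimately show ?thesis by (simp add: history_path_def)
qed

text \<open>The controls may vary with \<open>n\<close> without converging: the Lipschitz estimate
  is uniform over \<open>U\<close>.\<close>

lemma velocity_diff_tendsto:
  assumes x: "\<And>n. history_path (x n)" and lim: "uniform_limit {-tau..T} x y sequentially"
    and t: "t \<in> {0..T}" and u: "\<And>n. u n \<in> U"
  shows "(\<lambda>n. f (x n t) (D (x n) t) (u n) - f (y t) (D y t) (u n)) \<longlonglongrightarrow> 0"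
proof (rule LIMSEQ_I)
  fix e :: real assume "e > 0"
  then have "e / (2 * growth) > 0" using growth_pos by simp
  from uniform_limitD[OF lim this] obtain N where
    N: "\<And>n s. n \<ge> N \<Longrightarrow> s \<in> {-tau..T} \<Longrightarrow> dist (x n s) (y s) < e / (2 * growth)"
    unfolding eventually_sequentially by blast
  have "norm (f (x n t) (D (x n) t) (u n) - f (y t) (D y t) (u n)) \<le> growth * (e / (2 * growth))" if "n \<ge> N" for n
  proof (rule velocity_diff_le[OF x history_path_uniform_limit[OF x lim] u t])
    fix s assume "s \<in> {t - tau..t}"
    then show "norm (x n s - y s) \<le> e / (2 * growth)"
      using N[OF that, of s] t by (auto simp: dist_norm)
  qed
  moreover have "growth * (e / (2 * growth)) < e" using growth_pos \<open>e > 0\<close> by simp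
  ultimately show "\<exists>no. \<forall>n\<ge>no. norm (f (x n t) (D (x n) t) (u n) - f (y t) (D y t) (u n) - 0) < e"
    by (intro exI[of _ N]) (auto intro: le_less_trans)
qed

lemma velocity_integral_tendsto:
  assumes x: "\<And>n. history_path (x n)" and lim: "uniform_limit {-tau..T} x y sequentially"
    and u: "admissible u" and t: "t \<in> {0..T}"
  shows "(\<lambda>n. integral {0..t} (velocity (x n) u)) \<longlonglongrightarrow> integral {0..t} (velocity y u)"
proof (rule LIMSEQ_I)
  fix e :: real assume "e > 0"
  \<comment> \<open>Dividing by the largest weight turns the contraction estimate into an unweighted
    bound, and its factor 1/2 makes the final inequality strict.\<close>
  define e' where "e' = e / exp (2 * growth * T)"
  have "e' > 0" using \<open>e > 0\<close> by (simp add: e'_def)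
  from uniform_limitD[OF lim this] obtain N where
    N: "\<And>n s. n \<ge> N \<Longrightarrow> s \<in> {-tau..T} \<Longrightarrow> dist (x n s) (y s) < e'"
    unfolding eventually_sequentially by blast
  have "norm (integral {0..t} (velocity (x n) u) - integral {0..t} (velocity y u)) < e" if "n \<ge> N" for n
  proof -
    have "norm (integral {0..t} (velocity (x n) u) - integral {0..t} (velocity y u)) \<le> e' / 2 * exp (2 * growth * t)"
    proof (rule velocity_integral_contraction[OF x history_path_uniform_limit[OF x lim] u t])
      fix s assume s: "s \<in> {0..T}"
      then have "norm (x n s - y s) \<le> e' * 1"
        using N[OF that, of s] tau_pos by (auto simp: dist_norm)
      also have "\<dots> \<le> e' * exp (2 * growth * s)"
        using s growth_pos \<open>e' > 0\<close> by (intro mult_left_mono) auto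
      finally show "norm (x n s - y s) \<le> e' * exp (2 * growth * s)" .
    qed (use \<open>e' > 0\<close> in auto)
    also have "\<dots> \<le> e' / 2 * exp (2 * growth * T)"
      using t growth_pos \<open>e' > 0\<close> by (intro mult_left_mono) auto
    also have "\<dots> < e" using \<open>e > 0\<close> by (simp add: e'_def)
    finally show ?thesis .
  qed
  then show "\<exists>no. \<forall>n\<ge>no. norm (integral {0..t} (velocity (x n) u) - integral {0..t} (velocity y u)) < e" by blast
qed

text \<open>\<open>max 0 t\<close> makes the integral vanish on the history interval, so
  \<open>phi\<close> is kept there.\<close>

definition picard :: "(real \<Rightarrow> 'b) \<Rightarrow> (real \<Rightarrow> 'a) \<Rightarrow> real \<Rightarrow> 'a" where
  "picard u x t = constant_extension t + integral {0..max 0 t} (velocity x u)"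

lemma history_path_picard:
  assumes "history_path x" "admissible u"
  shows "history_path (picard u x)"
proof -
  have "continuous_on {0..T} (\<lambda>t. integral {0..t} (velocity x u))"
    using assms by (intro indefinite_integral_continuous_1 velocity_integrable) auto
  then have "continuous_on {-tau..T} (\<lambda>t. integral {0..max 0 t} (velocity x u))"
    by (rule continuous_on_compose2) (use T_pos in \<open>auto intro!: continuous_intros\<close>)
  then have "continuous_on {-tau..T} (picard u x)"
    unfolding picard_def[abs_def] using history_path_constant_extension
    by (intro continuous_on_add) (auto simp: history_path_def)
  then show ?thesis
    using history_path_constant_extension by (auto simp: history_path_def picard_def max_def)
qed

lemma integral_solution_exists:
  assumes u: "admissible u"
  shows "\<exists>x. integral_solution u x"
proof -
  obtain C where C: "0 \<le> C" "\<And>t u. t \<in> {0..T} \<Longrightarrow> u \<in> U \<Longrightarrow> norm (f (constant_extension t) (D constant_extension t) u) \<le> C"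
    using constant_extension_velocity_bound by blast
  define X where "X n = (picard u ^^ n) constant_extension" for n
  have X0: "X 0 = constant_extension" and XS: "X (Suc n) = picard u (X n)" for n by (simp_all add: X_def)
  have X: "history_path (X n)" for n
    by (induction n) (simp_all add: X0 XS history_path_constant_extension history_path_picard u)
  \<comment> \<open>\<open>C * T\<close> bounds the integral of the velocity along the constant
    extension, that is, the first increment; each further one gains the contraction factor
    1/2.\<close>
  have step: "norm (X (Suc n) t - X n t) \<le> C * T / 2^n * exp (2 * growth * t)" if "t \<in> {0..T}" for n t
    using that
  proof (induction n arbitrary: t)
    case 0
    have "norm (integral {0..t} (velocity constant_extension u)) \<le> integral {0..t} (\<lambda>_. C)"
      using 0 u by (intro integral_norm_bound_integral velocity_integrable history_path_constant_extension integrable_const_ivl)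
        (auto simp: velocity_def admissible_def intro!: C)
    also have "\<dots> \<le> C * T * 1" using 0 C by (auto intro!: mult_left_mono simp: mult.commute[of t C])
    also have "\<dots> \<le> C * T * exp (2 * growth * t)"
      using 0 C growth_pos T_pos by (intro mult_left_mono) auto
    finally show ?case using 0 by (simp add: X0 XS picard_def)
  next
    case (Suc n)
    have "norm (integral {0..t} (velocity (X (Suc n)) u) - integral {0..t} (velocity (X n) u))
        \<le> C * T / 2^n / 2 * exp (2 * growth * t)"
      using Suc C T_pos by (intro velocity_integral_contraction X u) auto
    then show ?case using Suc.prems by (simp add: XS[of "Suc n"] XS[of n] picard_def mult.commute)
  qed
  \<comment> \<open>Summing increments lets the Weierstrass test deliver a uniform limit;
    telescoping turns the partial sums back into \<open>X n\<close>.\<close>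
  have unif: "uniform_limit {-tau..T} (\<lambda>n t. \<Sum>i<n. X (Suc i) t - X i t) (\<lambda>t. \<Sum>i. X (Suc i) t - X i t) sequentially"
  proof (rule Weierstrass_m_test)
    have "summable (\<lambda>n. C * T * exp (2 * growth * T) * (1/2)^n)"
      by (intro summable_mult summable_geometric) auto
    then show "summable (\<lambda>n. C * T / 2^n * exp (2 * growth * T))"
      by (simp add: power_divide mult.commute mult.left_commute)
    fix n t assume t: "t \<in> {-tau..T}"
    show "norm (X (Suc n) t - X n t) \<le> C * T / 2^n * exp (2 * growth * T)"
    proof (cases "t < 0")
      case True
      then have "X (Suc n) t = X n t" using X[of n] X[of "Suc n"] t by (auto simp: history_path_def)
      then show ?thesis using C T_pos by simp
    next
      case False
      then have "norm (X (Suc n) t - X n t) \<le> C * T / 2^n * exp (2 * growth * t)" using t by (intro step) auto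
      also have "\<dots> \<le> C * T / 2^n * exp (2 * growth * T)"
        using C T_pos growth_pos t by (intro mult_left_mono) auto
      finally show ?thesis .
    qed
  qed
  define x where "x t = constant_extension t + (\<Sum>i. X (Suc i) t - X i t)" for t
  have "uniform_limit {-tau..T} (\<lambda>n t. constant_extension t + (\<Sum>i<n. X (Suc i) t - X i t)) x sequentially"
    unfolding x_def by (intro uniform_limit_intros unif)
  moreover have "constant_extension t + (\<Sum>i<n. X (Suc i) t - X i t) = X n t" for n t
    by (simp add: sum_lessThan_telescope[of "\<lambda>i. X i t"] X0)
  ultimately have lim: "uniform_limit {-tau..T} X x sequentially" by simp
  have x: "history_path x" by (rule history_path_uniform_limit[OF X lim])
  have "x t - phi 0 = integral {0..t} (velocity x u)" if t: "t \<in> {0..T}" for t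
  proof -
    have eq: "X (Suc n) t - phi 0 = integral {0..t} (velocity (X n) u)" for n
      using t by (simp add: XS picard_def constant_extension_def)
    have "(\<lambda>n. X (Suc n) t - phi 0) \<longlonglongrightarrow> x t - phi 0"
      using t tau_pos
      by (intro tendsto_diff tendsto_const LIMSEQ_Suc tendsto_uniform_limitI[OF lim]) auto
    then have "(\<lambda>n. integral {0..t} (velocity (X n) u)) \<longlonglongrightarrow> x t - phi 0"
      unfolding eq .
    then show ?thesis
      by (rule LIMSEQ_unique) (rule velocity_integral_tendsto[OF X lim u t])
  qed
  then show ?thesis
    using x u by (intro exI[of _ x]) (auto simp: integral_solution_def intro!: integrable_integral velocity_integrable)
qed

section \<open>Regularity of integral solutions and the differential form\<close>

lemma integral_solution_diff:
  assumes sol: "integral_solution u x" and u: "admissible u" and "s \<in> {0..T}" "t \<in> {0..T}" "s \<le> t"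
  shows "x t - x s = integral {s..t} (velocity x u)"
proof -
  have x: "history_path x" using sol by (simp add: integral_solution_def)
  have int: "integral {0..r} (velocity x u) = x r - phi 0" if "r \<in> {0..T}" for r
    using sol that by (intro integral_unique) (auto simp: integral_solution_def)
  have "integral {0..s} (velocity x u) + integral {s..t} (velocity x u) = integral {0..t} (velocity x u)"
    using assms by (intro Henstock_Kurzweil_Integration.integral_combine velocity_integrable x u) auto
  then show ?thesis using int[OF assms(3)] int[OF assms(4)] by (simp add: algebra_simps)
qed

lemma integral_solution_lipschitz:
  assumes sol: "integral_solution u x" and u: "admissible u"
    and B: "0 \<le> B" "\<And>t. t \<in> {0..T} \<Longrightarrow> norm (velocity x u t) \<le> B"
  shows "B-lipschitz_on {0..T} x"
proof -
  have x: "history_path x" using sol by (simp add: integral_solution_def)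
  have *: "norm (x t - x s) \<le> B * (t - s)" if st: "s \<in> {0..T}" "t \<in> {0..T}" "s \<le> t" for s t
  proof -
    have "norm (integral {s..t} (velocity x u)) \<le> integral {s..t} (\<lambda>_. B)"
      using st by (intro integral_norm_bound_integral velocity_integrable x u integrable_const_ivl B) auto
    then show ?thesis
      using st by (simp add: integral_solution_diff[OF sol u st] mult.commute)
  qed
  show ?thesis
  proof (rule lipschitz_onI)
    fix s t assume "s \<in> {0..T}" "t \<in> {0..T}"
    then show "dist (x s) (x t) \<le> B * dist s t"
      using *[of s t] *[of t s] by (cases "s \<le> t") (auto simp: dist_norm norm_minus_commute)
  qed (use B in auto)
qed

text \<open>Boundedness of the velocity gives the Lipschitz property, and Lebesgue differentiation
  the equation almost everywhere. Conversely, the Lipschitz property excludes a singular part when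
  the derivative is integrated back.\<close>

lemma integral_solution_iff:
  assumes u: "admissible u"
  shows "integral_solution u x \<longleftrightarrow> history_path x \<and> (\<exists>L. L-lipschitz_on {0..T} x) \<and>
    (AE t in lebesgue_on {0<..<T}. (x has_vector_derivative velocity x u t) (at t))"
proof (intro iffI conjI)
  assume sol: "integral_solution u x"
  then show x: "history_path x" by (simp add: integral_solution_def)
  obtain B where B: "\<And>u t. t \<in> {0..T} \<Longrightarrow> u \<in> U \<Longrightarrow> norm (f (x t) (D x t) u) \<le> B"
    using velocity_bounded[OF x] by blast
  have "(max B 0)-lipschitz_on {0..T} x"
    using B u by (intro integral_solution_lipschitz[OF sol u]) (auto simp: velocity_def admissible_def intro: max.coboundedI1)
  then show "\<exists>L. L-lipschitz_on {0..T} x" by blast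
  have "AE t in lebesgue_on {0<..<T}. ((\<lambda>s. integral {0..s} (velocity x u)) has_vector_derivative velocity x u t) (at t)"
    using x u by (intro AE_has_vector_derivative_integral velocity_integrable) auto
  then obtain N where N: "negligible N" "\<And>t. t \<in> {0<..<T} - N \<Longrightarrow>
      ((\<lambda>s. integral {0..s} (velocity x u)) has_vector_derivative velocity x u t) (at t)"
    by (subst (asm) AE_lebesgue_on_negligible) auto
  have "(x has_vector_derivative velocity x u t) (at t)" if t: "t \<in> {0<..<T} - N" for t
  proof (rule has_vector_derivative_transform_within_open)
    show "((\<lambda>s. phi 0 + integral {0..s} (velocity x u)) has_vector_derivative velocity x u t) (at t)"
      using has_vector_derivative_add[OF has_vector_derivative_const N(2)[OF t], of "phi 0"] by simp
    show "open {0<..<T}" "t \<in> {0<..<T}" using t by auto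
    fix s assume s: "s \<in> {0<..<T}"
    have "integral {0..s} (velocity x u) = x s - phi 0"
      using sol s by (intro integral_unique) (auto simp: integral_solution_def)
    then show "phi 0 + integral {0..s} (velocity x u) = x s" by simp
  qed
  then show "AE t in lebesgue_on {0<..<T}. (x has_vector_derivative velocity x u t) (at t)"
    using N(1) by (intro AE_lebesgue_on_negligible[THEN iffD2] exI[of _ N] conjI ballI) auto
next
  assume R: "history_path x \<and> (\<exists>L. L-lipschitz_on {0..T} x) \<and>
    (AE t in lebesgue_on {0<..<T}. (x has_vector_derivative velocity x u t) (at t))"
  then obtain L where L: "L-lipschitz_on {0..T} x" by blast
  obtain N where N: "negligible N" "\<And>t. t \<in> {0<..<T} - N \<Longrightarrow> (x has_vector_derivative velocity x u t) (at t)"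
    using R AE_lebesgue_on_negligible[of "{0<..<T}" "\<lambda>t. (x has_vector_derivative velocity x u t) (at t)"] by auto
  have "(velocity x u has_integral (x t - x 0)) {0..t}" if t: "t \<in> {0..T}" for t
  proof (rule lipschitz_on_has_integral_derivative)
    show "L-lipschitz_on {0..t} x" by (rule lipschitz_on_subset[OF L]) (use t in auto)
    show "AE s in lebesgue_on {0<..<t}. (x has_vector_derivative velocity x u s) (at s)"
      using N t by (intro AE_lebesgue_on_negligible[THEN iffD2] exI[of _ N] conjI ballI) auto
  qed (use t in auto)
  then show "integral_solution u x"
    using R tau_pos by (auto simp: integral_solution_def history_path_def)
qed

text \<open>A weighted maximum takes the role of Gronwall's lemma. At the time \<open>r\<close>
  where the weighted distance to the constant extension attains its maximum \<open>A\<close>, the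
  contraction bounds the distance by \<open>C * T\<close> plus half of itself, hence by
  \<open>2 * C * T\<close>. The weight is at least 1, so \<open>A\<close> obeys the same
  bound.\<close>

lemma integral_solution_bounds:
  obtains R B where "0 \<le> B"
    "\<And>u x t. admissible u \<Longrightarrow> integral_solution u x \<Longrightarrow> t \<in> {0..T} \<Longrightarrow> norm (x t) \<le> R"
    "\<And>u x t. admissible u \<Longrightarrow> integral_solution u x \<Longrightarrow> t \<in> {0..T} \<Longrightarrow> norm (velocity x u t) \<le> B"
proof -
  obtain C where C: "0 \<le> C" "\<And>t u. t \<in> {0..T} \<Longrightarrow> u \<in> U \<Longrightarrow> norm (f (constant_extension t) (D constant_extension t) u) \<le> C"
    using constant_extension_velocity_bound by blast
  define c where "c = 2 * C * T * exp (2 * growth * T)"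
  have "0 \<le> c" using C T_pos by (simp add: c_def)
  have dist: "norm (x s - constant_extension s) \<le> c"
    if u: "admissible u" and sol: "integral_solution u x" and s: "s \<in> {-tau..T}" for u x s
  proof (cases "s < 0")
    case True
    then show ?thesis using sol s history_path_constant_extension \<open>0 \<le> c\<close> by (auto simp: integral_solution_def history_path_def)
  next
    case False
    have x: "history_path x" using sol by (simp add: integral_solution_def)
    have "continuous_on {0..T} (\<lambda>t. norm (x t - constant_extension t) * exp (- (2 * growth * t)))"
      using x history_path_constant_extension tau_pos
      by (intro continuous_intros) (auto simp: history_path_def intro: continuous_on_subset)
    from continuous_attains_sup[OF compact_Icc _ this] T_pos
    obtain r where r: "r \<in> {0..T}" "\<And>t. t \<in> {0..T} \<Longrightarrow>
        norm (x t - constant_extension t) * exp (- (2 * growth * t)) \<le> norm (x r - constant_extension r) * exp (- (2 * growth * r))"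
      by auto
    define A where "A = norm (x r - constant_extension r) * exp (- (2 * growth * r))"
    have A: "norm (x t - constant_extension t) \<le> A * exp (2 * growth * t)" if "t \<in> {0..T}" for t
      using r(2)[OF that] by (simp add: A_def exp_minus field_simps)
    have "norm (integral {0..r} (velocity constant_extension u)) \<le> integral {0..r} (\<lambda>_. C)"
      using r u by (intro integral_norm_bound_integral velocity_integrable history_path_constant_extension integrable_const_ivl)
        (auto simp: velocity_def admissible_def intro!: C)
    also have "\<dots> \<le> C * T" using r C by (auto intro!: mult_left_mono simp: mult.commute[of r C])
    finally have 1: "norm (integral {0..r} (velocity constant_extension u)) \<le> C * T" .
    have "norm (integral {0..r} (velocity x u) - integral {0..r} (velocity constant_extension u)) \<le> A / 2 * exp (2 * growth * r)"
      by (rule velocity_integral_contraction[OF x history_path_constant_extension u r(1) _ A]) (auto simp: A_def)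
    moreover have "x r - constant_extension r = integral {0..r} (velocity x u)"
      using sol r(1) by (subst integral_unique[of _ "x r - phi 0"]) (auto simp: integral_solution_def constant_extension_def)
    moreover have "A * exp (2 * growth * r) = norm (x r - constant_extension r)"
      by (simp add: A_def exp_minus)
    ultimately have "A / 2 * exp (2 * growth * r) \<le> C * T"
      using 1 norm_triangle_sub[of "integral {0..r} (velocity x u)" "integral {0..r} (velocity constant_extension u)"] by simp
    moreover have "A / 2 * 1 \<le> A / 2 * exp (2 * growth * r)"
      using r(1) growth_pos by (intro mult_left_mono) (auto simp: A_def)
    ultimately have "A \<le> 2 * C * T" by simp
    have "norm (x s - constant_extension s) \<le> A * exp (2 * growth * s)" using s False by (intro A) auto
    also have "\<dots> \<le> 2 * C * T * exp (2 * growth * T)"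
      using s growth_pos \<open>A \<le> 2 * C * T\<close> by (intro mult_mono) (auto simp: A_def C T_pos less_imp_le)
    finally show ?thesis by (simp add: c_def)
  qed
  have "bounded (phi ` {-tau..0})"
    by (intro compact_imp_bounded compact_continuous_image phi_continuous compact_Icc)
  then obtain P where P: "\<forall>s\<in>{-tau..0}. norm (phi s) \<le> P"
    unfolding bounded_iff by auto
  show thesis
  proof (rule that)
    show "0 \<le> C + growth * c" using C \<open>0 \<le> c\<close> growth_pos by simp
  next
    fix u x t assume u: "admissible u" and sol: "integral_solution u x" and t: "t \<in> {0..T}"
    have "norm (constant_extension t) \<le> P" using t tau_pos P by (simp add: constant_extension_def)
    then show "norm (x t) \<le> P + c"
      using dist[OF u sol, of t] t tau_pos norm_triangle_sub[of "x t" "constant_extension t"] by auto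
    have "norm (velocity x u t - velocity constant_extension u t) \<le> growth * c"
      unfolding velocity_def using t u sol
      by (intro velocity_diff_le history_path_constant_extension dist[OF u sol]) (auto simp: admissible_def integral_solution_def)
    moreover have "norm (velocity constant_extension u t) \<le> C"
      using t u by (auto simp: velocity_def admissible_def intro!: C)
    ultimately show "norm (velocity x u t) \<le> C + growth * c"
      using norm_triangle_sub[of "velocity x u t" "velocity constant_extension u t"] by linarith
  qed
qed

lemma integral_solution_subsequence:
  assumes u: "\<And>n. admissible (u n)" and sol: "\<And>n. integral_solution (u n) (x n)"
  obtains y r where "strict_mono (r :: nat \<Rightarrow> nat)" "uniform_limit {-tau..T} (\<lambda>n. x (r n)) y sequentially"
proof -
  obtain R B where B: "0 \<le> B" and R: "\<And>n t. t \<in> {0..T} \<Longrightarrow> norm (x n t) \<le> R"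
    and V: "\<And>n t. t \<in> {0..T} \<Longrightarrow> norm (velocity (x n) (u n) t) \<le> B"
    using integral_solution_bounds u sol by metis
  have lip: "B-lipschitz_on {0..T} (x n)" for n
    by (rule integral_solution_lipschitz[OF sol u B V])
  have equi: "\<exists>d>0. \<forall>n t. t \<in> {0..T} \<and> norm (s - t) < d \<longrightarrow> norm (x n s - x n t) < e"
    if s: "s \<in> {0..T}" and "e > 0" for s e
  \<comment> \<open>\<open>B\<close> may be 0, hence the \<open>+ 1\<close> in the
    denominator.\<close>
  proof (intro exI[of _ "e / (B + 1)"] conjI allI impI)
    show "0 < e / (B + 1)" using B \<open>e > 0\<close> by simp
    fix n t assume t: "t \<in> {0..T} \<and> norm (s - t) < e / (B + 1)"
    have "norm (x n s - x n t) \<le> B * norm (s - t)"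
      using lipschitz_onD[OF lip s] t by (simp add: dist_norm)
    also have "\<dots> \<le> (B + 1) * norm (s - t)" by (simp add: distrib_right)
    also have "\<dots> < (B + 1) * (e / (B + 1))" using t B by (intro mult_strict_left_mono) auto
    finally show "norm (x n s - x n t) < e" using B by simp
  qed
  obtain g r where g: "continuous_on {0..T} g" "strict_mono (r :: nat \<Rightarrow> nat)"
      "\<And>e. 0 < e \<Longrightarrow> \<exists>N. \<forall>n t. n \<ge> N \<and> t \<in> {0..T} \<longrightarrow> norm (x (r n) t - g t) < e"
    by (rule Arzela_Ascoli[of "{0..T}" x R]) (use R equi in auto)
  \<comment> \<open>No Lipschitz bound holds on the history interval, where \<open>phi\<close> is
    merely continuous; but all states coincide there, so the limit on \<open>{0..T}\<close> only has
    to be glued to \<open>phi\<close>.\<close>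
  have "uniform_limit {-tau..T} (\<lambda>n. x (r n)) (\<lambda>t. if t < 0 then phi t else g t) sequentially"
  proof (rule uniform_limitI)
    fix e :: real assume "e > 0"
    then obtain N where N: "\<And>n t. n \<ge> N \<Longrightarrow> t \<in> {0..T} \<Longrightarrow> norm (x (r n) t - g t) < e"
      using g(3) by blast
    have "dist (x (r n) t) (if t < 0 then phi t else g t) < e" if "n \<ge> N" "t \<in> {-tau..T}" for n t
      using N[OF that(1), of t] that(2) sol[of "r n"] \<open>e > 0\<close>
      by (auto simp: dist_norm integral_solution_def history_path_def)
    then show "\<forall>\<^sub>F n in sequentially. \<forall>t\<in>{-tau..T}. dist (x (r n) t) (if t < 0 then phi t else g t) < e"
      unfolding eventually_sequentially by blast
  qed
  then show thesis using g(2) that by blast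
qed

text \<open>The weights sum to 1, so the constant part \<open>f x v 0\<close> of the affine map is
  reproduced by averaging.\<close>

lemma velocity_affine:
  assumes "p \<in> tail_weights i"
  shows "f x v (wsum p g) = wsum p (\<lambda>j. f x v (g j))"
proof -
  have "f x v (wsum p g) - f x v 0 = wsum p (\<lambda>j. f x v (g j) - f x v 0)"
    by (rule linear_wsum[OF f_affine])
  then show ?thesis by (simp add: wsum_diff wsum_const[OF assms])
qed

text \<open>Averaged velocities along the \<open>x n\<close> are compared with the velocity along
  \<open>y\<close> under the averaged control: the states enter through an error vanishing at each
  time, the controls through affinity. The averaged increments \<open>x n t - phi 0\<close> tend to
  \<open>y t - phi 0\<close>, so \<open>v\<close> drives \<open>y\<close> although the
  \<open>u n\<close> themselves need not converge.\<close>

lemma integral_solution_limit: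
  assumes u: "\<And>n. admissible (u n)" and sol: "\<And>n. integral_solution (u n) (x n)"
    and lim: "uniform_limit {-tau..T} x y sequentially"
    and w: "\<And>i. w i \<in> tail_weights i" and N: "negligible N"
    and v: "\<And>t. t \<in> {0..T} - N \<Longrightarrow> (\<lambda>i. wsum (w i) (\<lambda>n. u n t)) \<longlonglongrightarrow> v t"
  shows "integral_solution v y"
proof -
  have x: "history_path (x n)" for n using sol by (simp add: integral_solution_def)
  have y: "history_path y" by (rule history_path_uniform_limit[OF x lim])
  obtain R B where B: "0 \<le> B" and V: "\<And>n t. t \<in> {0..T} \<Longrightarrow> norm (velocity (x n) (u n) t) \<le> B"
    using integral_solution_bounds u sol by metis
  have "(velocity y v has_integral (y t - phi 0)) {0..t}" if t: "t \<in> {0..T}" for t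
  proof (rule has_integral_dominated_convergence_negligible[OF _ _ N,
        where f="\<lambda>i s. wsum (w i) (\<lambda>n. velocity (x n) (u n) s)" and h="\<lambda>_. B"])
    show "((\<lambda>s. wsum (w i) (\<lambda>n. velocity (x n) (u n) s)) has_integral wsum (w i) (\<lambda>n. x n t - phi 0)) {0..t}" for i
      unfolding wsum_def using sol t
      by (intro has_integral_sum has_integral_cmul) (auto simp: integral_solution_def)
    show "norm (wsum (w i) (\<lambda>n. velocity (x n) (u n) s)) \<le> B" if "s \<in> {0..t} - N" for i s
      using that t by (intro norm_wsum_le_bound[OF w] V) auto
    show "(\<lambda>i. wsum (w i) (\<lambda>n. velocity (x n) (u n) s)) \<longlonglongrightarrow> velocity y v s" if s: "s \<in> {0..t} - N" for s
    proof -
      have s': "s \<in> {0..T}" using s t by auto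
      have "(\<lambda>n. velocity (x n) (u n) s - f (y s) (D y s) (u n s)) \<longlonglongrightarrow> 0"
        unfolding velocity_def using u s' by (intro velocity_diff_tendsto[OF x lim s']) (auto simp: admissible_def)
      from wsum_tendsto[OF w this]
      have "(\<lambda>i. wsum (w i) (\<lambda>n. velocity (x n) (u n) s) - f (y s) (D y s) (wsum (w i) (\<lambda>n. u n s))) \<longlonglongrightarrow> 0"
        by (simp add: wsum_diff velocity_affine[OF w])
      moreover have "(\<lambda>i. f (y s) (D y s) (wsum (w i) (\<lambda>n. u n s))) \<longlonglongrightarrow> f (y s) (D y s) (v s)"
      proof -
        have "(\<lambda>i. (y s, D y s, wsum (w i) (\<lambda>n. u n s))) \<longlonglongrightarrow> (y s, D y s, v s)"
          using s t by (intro tendsto_intros v) auto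
        from continuous_on_tendsto_compose[OF f_continuous this] show ?thesis by simp
      qed
      ultimately show ?thesis
        using tendsto_add[of _ 0 _ _ "f (y s) (D y s) (v s)"] by (fastforce simp: velocity_def)
    qed
    have "(\<lambda>n. x n t - phi 0) \<longlonglongrightarrow> y t - phi 0"
      using t tau_pos by (intro tendsto_diff tendsto_const tendsto_uniform_limitI[OF lim]) auto
    from wsum_tendsto[OF w this] show "(\<lambda>i. wsum (w i) (\<lambda>n. x n t - phi 0)) \<longlonglongrightarrow> y t - phi 0" .
  qed (rule integrable_const_ivl)
  then show ?thesis using y by (simp add: integral_solution_def)
qed

end

section \<open>Lower semicontinuity and existence of minimizers\<close>

lemma convex_on_norm_diff_square:
  fixes c :: "'a::real_inner"
  shows "convex_on UNIV (\<lambda>x. (norm (x - c))\<^sup>2)"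
proof (rule convex_onI)
  fix t :: real and x y :: 'a
  assume t: "0 < t" "t < 1"
  define a b where "a = x - c" and "b = y - c"
  have 1: "(1 - t) *\<^sub>R x + t *\<^sub>R y - c = (1 - t) *\<^sub>R a + t *\<^sub>R b"
    by (simp add: a_def b_def algebra_simps)
  have 2: "(1 - t) * (norm a)\<^sup>2 + t * (norm b)\<^sup>2 - (norm ((1 - t) *\<^sub>R a + t *\<^sub>R b))\<^sup>2
      = t * (1 - t) * (norm (a - b))\<^sup>2"
    unfolding power2_norm_eq_inner
    by (simp add: inner_add_left inner_add_right inner_diff_left inner_diff_right inner_commute) algebra
  have 3: "t * (1 - t) * (norm (a - b))\<^sup>2 \<ge> 0" using t by simp
  show "(norm ((1 - t) *\<^sub>R x + t *\<^sub>R y - c))\<^sup>2 \<le> (1 - t) * (norm (x - c))\<^sup>2 + t * (norm (y - c))\<^sup>2"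
    using 2 3 unfolding 1 unfolding a_def b_def by linarith
qed simp

text \<open>Mean value inequality on a ball, with the gradient bounded by compactness of
  \<open>cball y 1 \<times> U\<close>. A constant depending on \<open>y\<close> suffices because the
  states converge to \<open>y\<close>.\<close>

lemma uniform_lipschitz_of_derivative:
  fixes h :: "'a::euclidean_space \<Rightarrow> 'b::euclidean_space \<Rightarrow> real"
  assumes der: "\<And>x u. ((\<lambda>y. h y u) has_derivative (\<lambda>d. hx x u \<bullet> d)) (at x)"
    and cont: "continuous_on UNIV (\<lambda>(x, u). hx x u)" and U: "compact U"
  obtains M where "0 \<le> M" "\<And>x u. x \<in> cball y 1 \<Longrightarrow> u \<in> U \<Longrightarrow> \<bar>h x u - h y u\<bar> \<le> M * norm (x - y)"
proof -
  have "compact ((\<lambda>(x, u). hx x u) ` (cball y 1 \<times> U))"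
    using U by (intro compact_continuous_image compact_Times continuous_on_subset[OF cont]) auto
  then have "bounded ((\<lambda>(x, u). hx x u) ` (cball y 1 \<times> U))" by (rule compact_imp_bounded)
  then obtain M where M: "0 < M" "\<forall>z\<in>cball y 1 \<times> U. norm (case z of (x, u) \<Rightarrow> hx x u) \<le> M"
    unfolding bounded_pos by auto
  show thesis
  proof (rule that)
    fix x u assume x: "x \<in> cball y 1" and u: "u \<in> U"
    have "norm (h x u - h y u) \<le> M * norm (x - y)"
    proof (rule differentiable_bound[where S="cball y 1" and f'="\<lambda>x d. hx x u \<bullet> d"])
      show "((\<lambda>x. h x u) has_derivative (\<lambda>d. hx z u \<bullet> d)) (at z within cball y 1)" for z
        by (rule has_derivative_at_withinI[OF der])
      show "onorm (\<lambda>d. hx z u \<bullet> d) \<le> M" if "z \<in> cball y 1" for z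
      proof (rule onorm_le)
        fix d
        have "norm (hx z u \<bullet> d) \<le> norm (hx z u) * norm d" using Cauchy_Schwarz_ineq2 by simp
        also have "\<dots> \<le> M * norm d" using M(2) that u by (intro mult_right_mono) auto
        finally show "norm (hx z u \<bullet> d) \<le> M * norm d" .
      qed
    qed (use x in auto)
    then show "\<bar>h x u - h y u\<bar> \<le> M * norm (x - y)" by simp
  qed (use M in simp)
qed

text \<open>The state is frozen at \<open>y\<close> first, with an error that vanishes by the local
  Lipschitz bound; Jensen's inequality is then applied to \<open>h y\<close> alone, whose continuity
  follows from finite convexity.\<close>

lemma convex_integrand_liminf:
  fixes h :: "'a::euclidean_space \<Rightarrow> 'b::euclidean_space \<Rightarrow> real"
  assumes conv: "\<And>x. convex_on UNIV (h x)"
    and der: "\<And>x u. ((\<lambda>y. h y u) has_derivative (\<lambda>d. hx x u \<bullet> d)) (at x)"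
    and cont: "continuous_on UNIV (\<lambda>(x, u). hx x u)" and U: "compact U"
    and u: "\<And>n. u n \<in> U" and x: "x \<longlonglongrightarrow> y"
    and w: "\<And>i. w i \<in> tail_weights i" and v: "(\<lambda>i. wsum (w i) u) \<longlonglongrightarrow> v"
  shows "ennreal (h y v) \<le> liminf (\<lambda>i. ennreal (wsum (w i) (\<lambda>n. h (x n) (u n))))"
proof -
  obtain M where M: "0 \<le> M" "\<And>x u. x \<in> cball y 1 \<Longrightarrow> u \<in> U \<Longrightarrow> \<bar>h x u - h y u\<bar> \<le> M * norm (x - y)"
    using uniform_lipschitz_of_derivative[OF der cont U] by blast
  have "\<forall>\<^sub>F n in sequentially. norm (h (x n) (u n) - h y (u n)) \<le> M * norm (x n - y)"
    using tendstoD[OF x zero_less_one]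
  proof eventually_elim
    case (elim n)
    then show ?case using M(2)[of "x n" "u n"] u by (simp add: dist_commute)
  qed
  moreover have "(\<lambda>n. M * norm (x n - y)) \<longlonglongrightarrow> 0"
    using x by (intro tendsto_mult_right_zero) (simp add: tendsto_norm_zero LIM_zero)
  ultimately have diff: "(\<lambda>n. h (x n) (u n) - h y (u n)) \<longlonglongrightarrow> 0"
    by (rule Lim_null_comparison)
  \<comment> \<open>A convergent minorant of the averaged costs: Jensen's inequality bounds the
    first term, and the second is the averaged freezing error.\<close>
  define l where "l i = h y (wsum (w i) u) + wsum (w i) (\<lambda>n. h (x n) (u n) - h y (u n))" for i
  have "continuous_on UNIV (h y)" using conv by (intro convex_on_continuous) auto
  from continuous_on_tendsto_compose[OF this v] have "(\<lambda>i. h y (wsum (w i) u)) \<longlonglongrightarrow> h y v" by simp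
  from tendsto_add[OF this wsum_tendsto[OF w diff]] have "l \<longlonglongrightarrow> h y v"
    by (simp add: l_def[abs_def])
  then have "liminf (\<lambda>i. ennreal (l i)) = ennreal (h y v)"
    by (intro lim_imp_Liminf tendsto_ennrealI) auto
  moreover have "l i \<le> wsum (w i) (\<lambda>n. h (x n) (u n))" for i
    using convex_on_wsum[OF w[of i] conv[of y], of u] by (simp add: l_def wsum_diff)
  then have "liminf (\<lambda>i. ennreal (l i)) \<le> liminf (\<lambda>i. ennreal (wsum (w i) (\<lambda>n. h (x n) (u n))))"
    by (intro Liminf_mono always_eventually allI ennreal_leI)
  ultimately show ?thesis by simp
qed

lemma nn_integral_wsum_le:
  fixes g :: "nat \<Rightarrow> 'a \<Rightarrow> real"
  assumes p: "p \<in> tail_weights i" and g: "\<And>n. g n \<in> borel_measurable M"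
    and nonneg: "\<And>n t. t \<in> space M \<Longrightarrow> 0 \<le> g n t"
    and le: "\<And>n. n \<ge> i \<Longrightarrow> (\<integral>\<^sup>+ t. ennreal (g n t) \<partial>M) \<le> b"
  shows "(\<integral>\<^sup>+ t. ennreal (wsum p (\<lambda>n. g n t)) \<partial>M) \<le> b"
proof -
  have p0: "\<And>j. 0 \<le> snd p j" "\<And>j. j < i \<Longrightarrow> snd p j = 0" "(\<Sum>j<fst p. snd p j) = 1"
    using p by (auto simp: tail_weights_def)
  have "(\<integral>\<^sup>+ t. ennreal (wsum p (\<lambda>n. g n t)) \<partial>M) = (\<integral>\<^sup>+ t. (\<Sum>j<fst p. ennreal (snd p j) * ennreal (g j t)) \<partial>M)"
    using p0(1) nonneg
    by (intro nn_integral_cong) (simp add: wsum_def sum_ennreal[symmetric] ennreal_mult)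
  also have "\<dots> = (\<Sum>j<fst p. ennreal (snd p j) * (\<integral>\<^sup>+ t. ennreal (g j t) \<partial>M))"
    using g by (simp add: nn_integral_sum nn_integral_cmult)
  also have "\<dots> \<le> (\<Sum>j<fst p. ennreal (snd p j) * b)"
  proof (rule sum_mono)
    fix j
    \<comment> \<open>Below \<open>i\<close> no bound on the integral is assumed, but there the
      weight 0 annihilates it even if it is infinite.\<close>
    show "ennreal (snd p j) * (\<integral>\<^sup>+ t. ennreal (g j t) \<partial>M) \<le> ennreal (snd p j) * b"
      using p0(2)[of j] le[of j] by (cases "j < i") (auto intro: mult_left_mono)
  qed
  also have "\<dots> = b" using p0 by (simp add: sum_distrib_right[symmetric] sum_ennreal)
  finally show ?thesis .
qed

text \<open>Convexity of the squared norm passes the radius constraint on to the averages.\<close>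

lemma integral_wsum_square_le:
  fixes u :: "nat \<Rightarrow> 'a \<Rightarrow> 'b::euclidean_space"
  assumes p: "p \<in> tail_weights i"
    and int: "\<And>n. integrable M (\<lambda>t. (norm (u n t - c t))\<^sup>2)"
    and int': "integrable M (\<lambda>t. (norm (wsum p (\<lambda>n. u n t) - c t))\<^sup>2)"
    and le: "\<And>n. (\<integral>t. (norm (u n t - c t))\<^sup>2 \<partial>M) \<le> b"
  shows "(\<integral>t. (norm (wsum p (\<lambda>n. u n t) - c t))\<^sup>2 \<partial>M) \<le> b"
proof -
  have "(\<integral>t. (norm (wsum p (\<lambda>n. u n t) - c t))\<^sup>2 \<partial>M) \<le> (\<integral>t. wsum p (\<lambda>n. (norm (u n t - c t))\<^sup>2) \<partial>M)"
    using int convex_on_wsum[OF p convex_on_norm_diff_square]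
    by (intro integral_mono int') (auto simp: wsum_def)
  also have "\<dots> = wsum p (\<lambda>n. \<integral>t. (norm (u n t - c t))\<^sup>2 \<partial>M)"
    using int by (simp add: wsum_def)
  also have "\<dots> \<le> wsum p (\<lambda>_. b)" by (rule wsum_mono[OF p le])
  finally show ?thesis by (simp add: wsum_const[OF p])
qed

section \<open>Admissible limits and the direct method\<close>

context delay_control
begin

lemma cost_measurable:
  fixes u :: "real \<Rightarrow> 'b"
  assumes h: "(\<lambda>(t, z). h t (fst z) (snd z)) \<in> borel_measurable (lebesgue_on {0..T} \<Otimes>\<^sub>M borel)"
    and x: "history_path x" and u: "u \<in> borel_measurable (lebesgue_on {0..T})"
  shows "(\<lambda>t. h t (x t) (u t)) \<in> borel_measurable (lebesgue_on {0..T})"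
proof -
  have "continuous_on {0..T} x" using x tau_pos by (auto simp: history_path_def intro: continuous_on_subset)
  then have "x \<in> borel_measurable (lebesgue_on {0..T})"
    by (rule continuous_imp_measurable_on_sets_lebesgue) simp
  from borel_measurable_Pair[OF this u] have "(\<lambda>t. (t, (x t, u t))) \<in> measurable (lebesgue_on {0..T}) (lebesgue_on {0..T} \<Otimes>\<^sub>M borel)"
    by (intro measurable_Pair measurable_ident_sets) simp_all
  from measurable_compose[OF this h] show ?thesis by simp
qed

lemma square_integrable_admissible:
  assumes "admissible u" "admissible v"
  shows "integrable (lebesgue_on {0..T}) (\<lambda>t. (norm (u t - v t))\<^sup>2)"
proof -
  interpret finite_measure "lebesgue_on {0..T}" by (rule finite_measure_lebesgue_on) simp
  obtain B where B: "\<And>z. z \<in> U \<Longrightarrow> norm z \<le> B"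
    using compact_imp_bounded[OF U_compact] unfolding bounded_iff by blast
  have [measurable]: "u \<in> borel_measurable (lebesgue_on {0..T})" "v \<in> borel_measurable (lebesgue_on {0..T})"
    using assms by (auto simp: admissible_def)
  have "norm (u t - v t) \<le> B + B" if "t \<in> {0..T}" for t
    using assms that by (intro order_trans[OF norm_triangle_ineq4] add_mono B) (auto simp: admissible_def)
  from power_mono[OF this norm_ge_zero, where n=2] show ?thesis
    by (intro integrable_const_bound[where B="(B + B)\<^sup>2"] AE_I2) (simp_all only: real_norm_def abs_power2 space_lebesgue_on, measurable)
qed

lemma admissible_wsum:
  assumes "p \<in> tail_weights i" "convex U" "\<And>n. admissible (u n)"
  shows "admissible (\<lambda>t. wsum p (\<lambda>n. u n t))"
proof -
  have [measurable]: "u n \<in> borel_measurable (lebesgue_on {0..T})" for n using assms by (auto simp: admissible_def)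
  have "(\<lambda>t. wsum p (\<lambda>n. u n t)) \<in> borel_measurable (lebesgue_on {0..T})" unfolding wsum_def by measurable
  then show ?thesis using assms(3) by (auto simp: admissible_def intro!: convex_wsum[OF assms(1,2)])
qed

lemma admissible_tail_limit:
  assumes U: "convex U" and u: "\<And>n. admissible (u n)"
  obtains w v N where "\<And>i. w i \<in> tail_weights i" "admissible v" "negligible N"
    "\<And>t. t \<in> {0..T} - N \<Longrightarrow> (\<lambda>i. wsum (w i) (\<lambda>n. u n t)) \<longlonglongrightarrow> v t"
proof -
  obtain B where B: "\<And>z. z \<in> U \<Longrightarrow> norm z \<le> B"
    using compact_imp_bounded[OF U_compact] unfolding bounded_iff by blast
  have um[measurable]: "u n \<in> borel_measurable (lebesgue_on {0..T})" for n using u by (auto simp: admissible_def)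
  have "finite_measure (lebesgue_on {0..T})" by (rule finite_measure_lebesgue_on) simp
  then obtain w where w: "\<And>i. w i \<in> tail_weights i"
    "AE t in lebesgue_on {0..T}. convergent (\<lambda>i. wsum (w i) (\<lambda>n. u n t))"
    by (rule ae_convergent_tail_averages[where u=u and B=B]) (use u in \<open>auto simp: admissible_def intro!: B\<close>)
  define V where "V i t = wsum (w i) (\<lambda>n. u n t)" for i t
  have [measurable]: "V i \<in> borel_measurable (lebesgue_on {0..T})" for i
    unfolding V_def[abs_def] wsum_def by measurable
  \<comment> \<open>Where the averages diverge, the value \<open>u 0 t\<close> keeps
    \<open>v\<close> inside \<open>U\<close>, so \<open>v\<close> is admissible at every
    time.\<close>
  define v where "v t = (if convergent (\<lambda>i. V i t) then lim (\<lambda>i. V i t) else u 0 t)" for t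
  have [measurable]: "Measurable.pred (lebesgue_on {0..T}) (\<lambda>t. convergent (\<lambda>i. V i t))"
    unfolding Cauchy_convergent_iff[symmetric] by measurable
  have "v \<in> borel_measurable (lebesgue_on {0..T})" unfolding v_def[abs_def] by measurable
  moreover have "v t \<in> U" if t: "t \<in> {0..T}" for t
  proof (cases "convergent (\<lambda>i. V i t)")
    case True
    then have lim: "(\<lambda>i. V i t) \<longlonglongrightarrow> v t" by (simp add: v_def convergent_LIMSEQ_iff)
    have "V i t \<in> U" for i
      unfolding V_def by (rule convex_wsum[OF w(1) U]) (use u t in \<open>simp add: admissible_def\<close>)
    then show ?thesis
      by (rule Lim_in_closed_set[OF compact_imp_closed[OF U_compact] always_eventually[OF allI] _ lim]) simp
  next
    case False
    then show ?thesis using u t by (auto simp: v_def admissible_def)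
  qed
  ultimately have "admissible v" by (simp add: admissible_def)
  moreover obtain N where N: "negligible N" "\<And>t. t \<in> {0..T} - N \<Longrightarrow> convergent (\<lambda>i. V i t)"
    using w(2) AE_lebesgue_on_negligible[of "{0..T}" "\<lambda>t. convergent (\<lambda>i. V i t)"] by (auto simp: V_def)
  ultimately show thesis
    using w(1) by (intro that[of w v N]) (auto simp: v_def convergent_LIMSEQ_iff V_def[symmetric])
qed

text \<open>The minimization runs over pairs of state and control. The constraint is a bound on the
  squared distance \<open>E\<close>, which passes through convexity and Fatou's lemma without square
  roots; \<open>ref\<close> satisfies it with value 0 and makes the set of competitors
  nonempty.\<close>

lemma optimal_control_exists:
  assumes U: "convex U" and ref: "admissible ref" and c: "0 \<le> c"
    and h_nonneg: "\<And>t x u. t \<in> {0..T} \<Longrightarrow> 0 \<le> h t x u"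
    and h_measurable: "(\<lambda>(t, z). h t (fst z) (snd z)) \<in> borel_measurable (lebesgue_on {0..T} \<Otimes>\<^sub>M borel)"
    and h_convex: "\<And>t x. t \<in> {0..T} \<Longrightarrow> convex_on UNIV (h t x)"
    and h_deriv: "\<And>t x u. t \<in> {0..T} \<Longrightarrow> ((\<lambda>y. h t y u) has_derivative (\<lambda>d. hx t x u \<bullet> d)) (at x)"
    and hx_cont: "\<And>t. t \<in> {0..T} \<Longrightarrow> continuous_on UNIV (\<lambda>(x, u). hx t x u)"
  defines "E \<equiv> \<lambda>u. \<integral>t. (norm (u t - ref t))\<^sup>2 \<partial>lebesgue_on {0..T}"
    and "cost \<equiv> \<lambda>x u. \<integral>\<^sup>+ t. ennreal (h t (x t) (u t)) \<partial>lebesgue_on {0..T}"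
  shows "\<exists>y v. admissible v \<and> E v \<le> c \<and> integral_solution v y \<and>
    (\<forall>x u. admissible u \<and> E u \<le> c \<and> integral_solution u x \<longrightarrow> cost y v \<le> cost x u)"
proof -
  define S where "S = {(x, u). admissible u \<and> E u \<le> c \<and> integral_solution u x}"
  obtain x0 where "integral_solution ref x0" using integral_solution_exists[OF ref] by blast
  then have "(x0, ref) \<in> S" using ref c by (simp add: S_def E_def)
  then have "(\<lambda>(x, u). cost x u) ` S \<noteq> {}" by blast
  \<comment> \<open>In \<open>ennreal\<close> the infimum is approached by a decreasing sequence of
    costs of competitors, even if all costs are infinite.\<close>
  from ennreal_Inf_countable_INF[OF this] obtain m :: "nat \<Rightarrow> ennreal" where
    m: "decseq m" "range m \<subseteq> (\<lambda>(x, u). cost x u) ` S" "Inf ((\<lambda>(x, u). cost x u) ` S) = (INF n. m n)" by blast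
  from m(2) have "\<forall>n. \<exists>z\<in>S. m n = (\<lambda>(x, u). cost x u) z" by blast
  then obtain z where z: "\<And>n. z n \<in> S" "\<And>n. m n = (\<lambda>(x, u). cost x u) (z n)" by metis
  define x1 u1 where "x1 n = fst (z n)" and "u1 n = snd (z n)" for n
  have z1: "admissible (u1 n)" "E (u1 n) \<le> c" "integral_solution (u1 n) (x1 n)" "cost (x1 n) (u1 n) = m n" for n
    using z[of n] by (auto simp: S_def x1_def u1_def split: prod.splits)
  obtain y r where r: "strict_mono (r :: nat \<Rightarrow> nat)" and lim: "uniform_limit {-tau..T} (\<lambda>n. x1 (r n)) y sequentially"
    using integral_solution_subsequence[of u1 x1] z1 by metis
  define x u where "x n = x1 (r n)" and "u n = u1 (r n)" for n
  have u: "\<And>n. admissible (u n)" and Eu: "\<And>n. E (u n) \<le> c" and sol: "\<And>n. integral_solution (u n) (x n)"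
    and lim: "uniform_limit {-tau..T} x y sequentially"
    using z1 lim by (simp_all add: x_def[abs_def] u_def)
  \<comment> \<open>Since \<open>r n \<ge> n\<close> and \<open>m\<close> decreases, every later
    cost is at most \<open>m i\<close>; this is the bound that tail averages inherit.\<close>
  have cost_le: "cost (x n) (u n) \<le> m i" if "i \<le> n" for n i
    using decseqD[OF m(1), of i "r n"] that seq_suble[OF r, of n] by (simp add: x_def u_def z1)
  obtain w v N where w: "\<And>i. w i \<in> tail_weights i" and v: "admissible v" and N: "negligible N"
    and vlim: "\<And>t. t \<in> {0..T} - N \<Longrightarrow> (\<lambda>i. wsum (w i) (\<lambda>n. u n t)) \<longlonglongrightarrow> v t"
    by (rule admissible_tail_limit[OF U, of u]) (use u in blast)+
  have y: "integral_solution v y" by (rule integral_solution_limit[OF u sol lim w N vlim])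
  have AE_I: "AE t in lebesgue_on {0..T}. P t" if "\<And>t. t \<in> {0..T} - N \<Longrightarrow> P t" for P
    using N that by (intro AE_lebesgue_on_negligible[THEN iffD2] exI[of _ N] conjI ballI) auto
  have um[measurable]: "u n \<in> borel_measurable (lebesgue_on {0..T})" "ref \<in> borel_measurable (lebesgue_on {0..T})"
    "v \<in> borel_measurable (lebesgue_on {0..T})" for n
    using u ref v by (auto simp: admissible_def)
  have hm: "(\<lambda>t. h t (x n t) (u n t)) \<in> borel_measurable (lebesgue_on {0..T})" for n
    using sol u by (intro cost_measurable[OF h_measurable]) (auto simp: integral_solution_def admissible_def)
  have Ev: "E v \<le> c"
  proof -
    \<comment> \<open>Fatou's lemma along the almost everywhere convergent averages replaces weak
      lower semicontinuity of the norm.\<close>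
    have "E v = (\<integral>\<^sup>+ t. ennreal ((norm (v t - ref t))\<^sup>2) \<partial>lebesgue_on {0..T})"
      unfolding E_def by (intro nn_integral_eq_integral[symmetric] square_integrable_admissible v ref) auto
    also have "\<dots> \<le> (\<integral>\<^sup>+ t. liminf (\<lambda>i. ennreal ((norm (wsum (w i) (\<lambda>n. u n t) - ref t))\<^sup>2)) \<partial>lebesgue_on {0..T})"
    proof (rule nn_integral_mono_AE, rule AE_I)
      fix t assume "t \<in> {0..T} - N"
      then have "(\<lambda>i. ennreal ((norm (wsum (w i) (\<lambda>n. u n t) - ref t))\<^sup>2)) \<longlonglongrightarrow> ennreal ((norm (v t - ref t))\<^sup>2)"
        by (intro tendsto_intros vlim)
      from lim_imp_Liminf[OF _ this] show "ennreal ((norm (v t - ref t))\<^sup>2) \<le> liminf (\<lambda>i. ennreal ((norm (wsum (w i) (\<lambda>n. u n t) - ref t))\<^sup>2))"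
        by simp
    qed
    also have "\<dots> \<le> liminf (\<lambda>i. \<integral>\<^sup>+ t. ennreal ((norm (wsum (w i) (\<lambda>n. u n t) - ref t))\<^sup>2) \<partial>lebesgue_on {0..T})"
      unfolding wsum_def by (intro nn_integral_liminf) measurable
    also have "\<dots> \<le> ennreal c"
    proof (intro Liminf_le always_eventually allI)
      fix i
      have int: "integrable (lebesgue_on {0..T}) (\<lambda>t. (norm (wsum (w i) (\<lambda>n. u n t) - ref t))\<^sup>2)"
        by (intro square_integrable_admissible admissible_wsum[OF w U] u ref)
      have "(\<integral>t. (norm (wsum (w i) (\<lambda>n. u n t) - ref t))\<^sup>2 \<partial>lebesgue_on {0..T}) \<le> c"
        using Eu by (intro integral_wsum_square_le[OF w] square_integrable_admissible u ref int) (simp add: E_def)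
      then show "(\<integral>\<^sup>+ t. ennreal ((norm (wsum (w i) (\<lambda>n. u n t) - ref t))\<^sup>2) \<partial>lebesgue_on {0..T}) \<le> ennreal c"
        using int by (simp add: nn_integral_eq_integral ennreal_leI)
    qed simp
    finally show ?thesis using c by simp
  qed
  \<comment> \<open>For fixed \<open>k\<close>, averages with \<open>i \<ge> k\<close> only involve
    costs at most \<open>m k\<close>; the infimum over \<open>k\<close> is taken afterwards. No
    integrable majorant of \<open>h\<close> is at hand, hence Fatou's lemma rather than dominated
    convergence.\<close>
  have "cost y v \<le> m k" for k
  proof -
    have "cost y v \<le> (\<integral>\<^sup>+ t. liminf (\<lambda>i. ennreal (wsum (w i) (\<lambda>n. h t (x n t) (u n t)))) \<partial>lebesgue_on {0..T})"
      unfolding cost_def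
    proof (rule nn_integral_mono_AE, rule AE_I)
      fix t assume t: "t \<in> {0..T} - N"
      then have t': "t \<in> {0..T}" by simp
      have "(\<lambda>n. x n t) \<longlonglongrightarrow> y t" using t tau_pos by (intro tendsto_uniform_limitI[OF lim]) auto
      then show "ennreal (h t (y t) (v t)) \<le> liminf (\<lambda>i. ennreal (wsum (w i) (\<lambda>n. h t (x n t) (u n t))))"
        using u t' by (intro convex_integrand_liminf[where h="h t" and u="\<lambda>n. u n t" and x="\<lambda>n. x n t",
              OF h_convex[OF t'] h_deriv[OF t'] hx_cont[OF t'] U_compact _ _ w vlim[OF t]]) (auto simp: admissible_def)
    qed
    also have "\<dots> \<le> liminf (\<lambda>i. \<integral>\<^sup>+ t. ennreal (wsum (w i) (\<lambda>n. h t (x n t) (u n t))) \<partial>lebesgue_on {0..T})"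
      unfolding wsum_def by (intro nn_integral_liminf) (use hm in measurable)
    also have "\<dots> \<le> m k"
    proof (rule Liminf_le)
      have "(\<integral>\<^sup>+ t. ennreal (wsum (w i) (\<lambda>n. h t (x n t) (u n t))) \<partial>lebesgue_on {0..T}) \<le> m k" if "i \<ge> k" for i
        using cost_le[of k] that by (intro nn_integral_wsum_le[OF w hm]) (auto intro: h_nonneg simp: cost_def)
      then show "\<forall>\<^sub>F i in sequentially. (\<integral>\<^sup>+ t. ennreal (wsum (w i) (\<lambda>n. h t (x n t) (u n t))) \<partial>lebesgue_on {0..T}) \<le> m k"
        unfolding eventually_sequentially by blast
    qed simp
    finally show ?thesis .
  qed
  then have Inf_le: "cost y v \<le> Inf ((\<lambda>(x, u). cost x u) ` S)" unfolding m(3) by (intro INF_greatest)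
  have opt: "cost y v \<le> cost x' u'" if "admissible u' \<and> E u' \<le> c \<and> integral_solution u' x'" for x' u'
  proof -
    have "(x', u') \<in> S" using that by (simp add: S_def)
    from imageI[OF this, of "\<lambda>(x, u). cost x u"]
    have "cost x' u' \<in> (\<lambda>(x, u). cost x u) ` S" by simp
    from order_trans[OF Inf_le Inf_lower[OF this]] show ?thesis .
  qed
  show ?thesis
    using v Ev y opt by (intro exI[of _ y] exI[of _ v] conjI allI impI)
qed

end

section \<open>Application to the regularized problem\<close>

text \<open>Connects the almost everywhere constraint with \<open>admissible\<close>; the lemmas
  that follow show that distance, cost and equation do not see the change.\<close>

lemma feasible_representative:
  assumes u: "feasible T U u" and U: "compact U" "U \<noteq> {}"
  obtains u' where "u' \<in> borel_measurable (lebesgue_on {0..T})" "\<And>t. u' t \<in> U"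
    "AE t in lebesgue_on {0..T}. u' t = u t"
proof -
  obtain c where c: "c \<in> U" using U by blast
  have [measurable]: "u \<in> borel_measurable (lebesgue_on {0..T})" "U \<in> sets borel"
    using u U by (auto simp: feasible_def compact_imp_closed)
  show thesis
  proof
    show "(\<lambda>t. if u t \<in> U then u t else c) \<in> borel_measurable (lebesgue_on {0..T})" by measurable
    show "(if u t \<in> U then u t else c) \<in> U" for t using c by simp
    have "AE t in lebesgue_on {0..T}. u t \<in> U" using u by (simp add: feasible_def)
    then show "AE t in lebesgue_on {0..T}. (if u t \<in> U then u t else c) = u t"
      by eventually_elim simp
  qed
qed

lemma L2dist_cong_AE:
  assumes "AE t in lebesgue_on {0..T}. u' t = u t" "AE t in lebesgue_on {0..T}. v' t = v t"
    and [measurable]: "u \<in> borel_measurable (lebesgue_on {0..T})" "u' \<in> borel_measurable (lebesgue_on {0..T})"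
      "v \<in> borel_measurable (lebesgue_on {0..T})" "v' \<in> borel_measurable (lebesgue_on {0..T})"
  shows "L2dist T u' v' = L2dist T u v"
proof -
  have "AE t in lebesgue_on {0..T}. (norm (u' t - v' t))\<^sup>2 = (norm (u t - v t))\<^sup>2"
    using assms(1,2) by eventually_elim simp
  then have "(\<integral>t. (norm (u' t - v' t))\<^sup>2 \<partial>lebesgue_on {0..T}) = (\<integral>t. (norm (u t - v t))\<^sup>2 \<partial>lebesgue_on {0..T})"
    by (intro integral_cong_AE) auto
  then show ?thesis by (simp add: L2dist_def)
qed

lemma Jcost_cong_AE:
  assumes "AE t in lebesgue_on {0..T}. u' t = u t"
  shows "Jcost T j x u' = Jcost T j x u"
proof -
  have "AE t in lebesgue_on {0..T}. ennreal (j t (x t) (u' t)) = ennreal (j t (x t) (u t))"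
    using assms by eventually_elim simp
  then show ?thesis unfolding Jcost_def by (rule nn_integral_cong_AE)
qed

lemma solves_delay_cong_AE:
  assumes "AE t in lebesgue_on {0..T}. u' t = u t"
  shows "solves_delay F0 F1 D tau T phi u' x \<longleftrightarrow> solves_delay F0 F1 D tau T phi u x"
proof -
  obtain N where N: "negligible N" "\<And>t. t \<in> {0..T} - N \<Longrightarrow> u' t = u t"
    using assms AE_lebesgue_on_negligible[of "{0..T}" "\<lambda>t. u' t = u t"] by auto
  have "AE t in lebesgue_on {0<..<T}. u' t = u t"
    using N by (intro AE_lebesgue_on_negligible[THEN iffD2] exI[of _ N] conjI ballI) auto
  then have "AE t in lebesgue_on {0<..<T}. (x has_vector_derivative rhs F0 F1 (x t) (D x t) (u' t)) (at t)
      \<longleftrightarrow> (x has_vector_derivative rhs F0 F1 (x t) (D x t) (u t)) (at t)"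
    by eventually_elim simp
  from eventually_subst[OF this]
  show ?thesis unfolding solves_delay_def by simp
qed

lemma convex_norm_penalty:
  fixes c :: "'b::euclidean_space"
  assumes "convex_on UNIV g"
  shows "convex_on UNIV (\<lambda>u. g u + (norm (u - c))\<^sup>2 / 2)"
proof -
  have "convex_on UNIV (\<lambda>u. (1/2) * (norm (u - c))\<^sup>2)"
    by (intro convex_on_cmul convex_on_norm_diff_square) simp
  from convex_on_add[OF assms this] show ?thesis by simp
qed

text \<open>Absorbs the penalty into the integrand, so that the regularized problem minimizes a
  single nonnegative integral.\<close>

lemma Jk_cost_eq_nn_integral:
  assumes "(\<lambda>t. j t (x t) (u t)) \<in> borel_measurable (lebesgue_on {0..T})"
    and nonneg: "\<And>t. t \<in> {0..T} \<Longrightarrow> 0 \<le> j t (x t) (u t)"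
    and int: "integrable (lebesgue_on {0..T}) (\<lambda>t. (norm (u t - v t))\<^sup>2)"
  shows "Jk_cost T j v x u = (\<integral>\<^sup>+ t. ennreal (j t (x t) (u t) + (norm (u t - v t))\<^sup>2 / 2) \<partial>lebesgue_on {0..T})"
proof -
  have "(L2dist T u v)\<^sup>2 / 2 = (\<integral>t. (norm (u t - v t))\<^sup>2 / 2 \<partial>lebesgue_on {0..T})"
    by (simp add: L2dist_def integral_nonneg_AE)
  then have "ennreal ((L2dist T u v)\<^sup>2 / 2) = (\<integral>\<^sup>+ t. ennreal ((norm (u t - v t))\<^sup>2 / 2) \<partial>lebesgue_on {0..T})"
    using int by (simp add: nn_integral_eq_integral)
  then have "Jk_cost T j v x u = (\<integral>\<^sup>+ t. ennreal (j t (x t) (u t)) + ennreal ((norm (u t - v t))\<^sup>2 / 2) \<partial>lebesgue_on {0..T})"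
    unfolding Jk_cost_def Jcost_def using assms(1) borel_measurable_integrable[OF int]
    by (simp add: nn_integral_add)
  also have "\<dots> = (\<integral>\<^sup>+ t. ennreal (j t (x t) (u t) + (norm (u t - v t))\<^sup>2 / 2) \<partial>lebesgue_on {0..T})"
    using nonneg by (intro nn_integral_cong) simp
  finally show ?thesis .
qed

text \<open>A state difference in \<open>F1\<close> is multiplied by the control, hence the bound
  \<open>B\<close> on \<open>U\<close> and the constant \<open>C\<close> of the matrix-vector
  product in the Lipschitz constant.\<close>

lemma rhs_lipschitz:
  fixes F1 :: "real^'n \<Rightarrow> real^'n \<Rightarrow> real^'m^'n"
  assumes "L0-lipschitz_on UNIV (\<lambda>(x, v). F0 x v)" "L1-lipschitz_on UNIV (\<lambda>(x, v). F1 x v)" "bounded U"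
  obtains K where "0 \<le> K"
    "\<And>x v y w u. u \<in> U \<Longrightarrow> norm (rhs F0 F1 x v u - rhs F0 F1 y w u) \<le> K * (norm (x - y) + norm (v - w))"
proof -
  interpret mv: bounded_bilinear "(*v) :: real^'m^'n \<Rightarrow> real^'m \<Rightarrow> real^'n"
    by (rule bounded_bilinear_matrix_vector_mult)
  obtain C where C: "0 < C" "\<And>(A :: real^'m^'n) u. norm (A *v u) \<le> norm A * norm u * C"
    using mv.pos_bounded by blast
  obtain B where B: "0 < B" "\<And>u. u \<in> U \<Longrightarrow> norm u \<le> B" using assms(3) unfolding bounded_pos by auto
  note L = lipschitz_on_nonneg[OF assms(1)] lipschitz_on_nonneg[OF assms(2)]
  show thesis
  proof (rule that)
    show "0 \<le> L0 + L1 * B * C" using L B C by simp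
    fix x v y w :: "real^'n" and u assume u: "u \<in> U"
    define d where "d = norm (x - y) + norm (v - w)"
    have d: "dist (x, v) (y, w) \<le> d"
      using norm_Pair_le[of "x - y" "v - w"] by (simp add: dist_norm d_def)
    have "norm (F0 x v - F0 y w) \<le> L0 * dist (x, v) (y, w)"
      using lipschitz_onD[OF assms(1), of "(x, v)" "(y, w)"] by (simp add: dist_norm)
    also have "\<dots> \<le> L0 * d" using d L by (intro mult_left_mono)
    finally have 0: "norm (F0 x v - F0 y w) \<le> L0 * d" .
    have "norm (F1 x v - F1 y w) \<le> L1 * dist (x, v) (y, w)"
      using lipschitz_onD[OF assms(2), of "(x, v)" "(y, w)"] by (simp add: dist_norm)
    also have "\<dots> \<le> L1 * d" using d L by (intro mult_left_mono)
    finally have 1: "norm (F1 x v - F1 y w) \<le> L1 * d" .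
    have "norm ((F1 x v - F1 y w) *v u) \<le> norm (F1 x v - F1 y w) * norm u * C" by (rule C)
    also have "\<dots> \<le> L1 * d * B * C"
      using 1 u B C L by (intro mult_mono mult_nonneg_nonneg) (auto simp: d_def)
    finally have 2: "norm ((F1 x v - F1 y w) *v u) \<le> L1 * d * B * C" .
    have "rhs F0 F1 x v u - rhs F0 F1 y w u = (F0 x v - F0 y w) + (F1 x v - F1 y w) *v u"
      by (simp add: rhs_def mv.diff_left)
    then have "norm (rhs F0 F1 x v u - rhs F0 F1 y w u) \<le> L0 * d + L1 * d * B * C"
      using norm_triangle_ineq[of "F0 x v - F0 y w" "(F1 x v - F1 y w) *v u"] 0 2 by simp
    then show "norm (rhs F0 F1 x v u - rhs F0 F1 y w u) \<le> (L0 + L1 * B * C) * (norm (x - y) + norm (v - w))"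
      unfolding d_def[symmetric] by (simp add: algebra_simps)
  qed
qed

lemma continuous_on_rhs:
  fixes F1 :: "real^'n \<Rightarrow> real^'n \<Rightarrow> real^'m^'n"
  assumes "continuous_on UNIV (\<lambda>(x, v). F0 x v)" "continuous_on UNIV (\<lambda>(x, v). F1 x v)"
  shows "continuous_on UNIV (\<lambda>(x, v, u). rhs F0 F1 x v u)"
proof -
  have "continuous_on UNIV (\<lambda>z :: (real^'n) \<times> (real^'n) \<times> (real^'m). (\<lambda>(x, v). F0 x v) (fst z, fst (snd z))
      + (\<lambda>(x, v). F1 x v) (fst z, fst (snd z)) *v snd (snd z))"
    by (intro continuous_intros bounded_bilinear.continuous_on[OF bounded_bilinear_matrix_vector_mult]
        continuous_on_compose2[OF assms(1)] continuous_on_compose2[OF assms(2)]) auto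
  then show ?thesis by (simp add: rhs_def case_prod_beta')
qed

theorem theorem5p4:
  fixes F0 :: "real^'n \<Rightarrow> real^'n \<Rightarrow> real^'n"
    and F1 :: "real^'n \<Rightarrow> real^'n \<Rightarrow> real^'m^'n"
    and T tau \<delta> :: real
    and phi :: "real \<Rightarrow> real^'n"
    and U :: "(real^'m) set"
    and j :: "real \<Rightarrow> real^'n \<Rightarrow> real^'m \<Rightarrow> real"
    and xs :: "real \<Rightarrow> real^'n" and us :: "real \<Rightarrow> real^'m"
  assumes "T > 0" and "tau > 0"
    and F0_lip: "\<exists>L. L-lipschitz_on UNIV (\<lambda>(x, v). F0 x v)"
    and F1_lip: "\<exists>L. L-lipschitz_on UNIV (\<lambda>(x, v). F1 x v)"
    and F0_C1: "\<exists>D. (\<forall>z. ((\<lambda>(x, v). F0 x v) has_derivative blinfun_apply (D z)) (at z)) \<and> continuous_on UNIV D"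
    and F1_C1: "\<exists>D. (\<forall>z. ((\<lambda>(x, v). F1 x v) has_derivative blinfun_apply (D z)) (at z)) \<and> continuous_on UNIV D"
    and phi_cont: "continuous_on {-tau..0} phi"
    and U: "U \<noteq> {}" "convex U" "compact U"
    and j_nonneg: "\<forall>t\<in>{0..T}. \<forall>x u. j t x u \<ge> 0"
    and j_normal: "normal_integrand T j"
    and j_convex: "\<forall>t\<in>{0..T}. \<forall>x. convex_on UNIV (j t x)"
    and j_diff: "\<exists>jx :: real \<Rightarrow> real^'n \<Rightarrow> real^'m \<Rightarrow> real^'n.
                   \<forall>t\<in>{0..T}. (\<forall>x u. ((\<lambda>y. j t y u) has_derivative (\<lambda>h. jx t x u \<bullet> h)) (at x)) \<and>
                     continuous_on UNIV (\<lambda>(x, u). jx t x u)"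
    and "\<delta> > 0"
    and loc: "local_solution_P F0 F1 tau T phi U j \<delta> xs us"
  shows "\<forall>k>0. \<exists>xk uk. global_solution_Pk F0 F1 k tau T phi U j \<delta> us xk uk"
proof (intro allI impI)
  fix k :: real assume "k > 0"
  obtain L0 L1 where L: "L0-lipschitz_on UNIV (\<lambda>(x, v). F0 x v)" "L1-lipschitz_on UNIV (\<lambda>(x, v). F1 x v)"
    using F0_lip F1_lip by blast
  obtain K where K: "0 \<le> K"
    "\<And>x v y w u. u \<in> U \<Longrightarrow> norm (rhs F0 F1 x v u - rhs F0 F1 y w u) \<le> K * (norm (x - y) + norm (v - w))"
    using rhs_lipschitz[OF L compact_imp_bounded[OF U(3)]] by blast
  interpret delay_control "rhs F0 F1" "LIE k tau" tau T phi U K "real CARD('n)"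
  proof (rule delay_control.intro)
    show "continuous_on UNIV (\<lambda>(x, v, u). rhs F0 F1 x v u)"
      using L by (intro continuous_on_rhs lipschitz_on_continuous_on)
    show "linear (\<lambda>u. rhs F0 F1 x v u - rhs F0 F1 x v 0)" for x v
      by (simp add: rhs_def matrix_vector_mul_linear)
    show "continuous_on {0..T} (LIE k tau x)" if "continuous_on {-tau..T} x" for x
      using \<open>tau > 0\<close> that by (rule continuous_on_LIE)
    show "norm (LIE k tau x t - LIE k tau y t) \<le> real CARD('n) * c"
      if "continuous_on {-tau..T} x" "continuous_on {-tau..T} y" "t \<in> {0..T}"
        "\<And>s. s \<in> {t - tau..t} \<Longrightarrow> norm (x s - y s) \<le> c" for x y :: "real \<Rightarrow> real^'n" and t c
      using that \<open>k > 0\<close> \<open>tau > 0\<close>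
      by (intro norm_LIE_diff_le continuous_on_subset[OF that(1)] continuous_on_subset[OF that(2)]) auto
  qed (use assms K in auto)
  have us: "feasible T U us" using loc by (simp add: local_solution_P_def)
  \<comment> \<open>\<open>us\<close> lies in \<open>U\<close> only almost everywhere; a
    representative with values in \<open>U\<close> at every time is an admissible reference, at
    distance zero from itself.\<close>
  obtain ref where ref: "ref \<in> borel_measurable (lebesgue_on {0..T})" "\<And>t. ref t \<in> U"
      "AE t in lebesgue_on {0..T}. ref t = us t"
    using feasible_representative[OF us U(3,1)] by blast
  have ref': "admissible ref" using ref by (simp add: admissible_def)
  have us_m: "us \<in> borel_measurable (lebesgue_on {0..T})" using us by (simp add: feasible_def)
  have solves: "solves_delay F0 F1 (LIE k tau) tau T phi u x \<longleftrightarrow> integral_solution u x" if "admissible u" for u x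
    unfolding integral_solution_iff[OF that] by (auto simp: solves_delay_def history_path_def velocity_def)
  have feas: "feasible T U u" if "admissible u" for u
  proof -
    obtain B where "\<And>z. z \<in> U \<Longrightarrow> norm z \<le> B" using compact_imp_bounded[OF U(3)] unfolding bounded_iff by blast
    then have "AE t in lebesgue_on {0..T}. norm (u t) \<le> B" "AE t in lebesgue_on {0..T}. u t \<in> U"
      using that by (auto simp: admissible_def intro!: AE_I2)
    then show ?thesis using that by (auto simp: feasible_def admissible_def)
  qed
  obtain jx where jx: "\<And>t x u. t \<in> {0..T} \<Longrightarrow> ((\<lambda>y. j t y u) has_derivative (\<lambda>h. jx t x u \<bullet> h)) (at x)"
      "\<And>t. t \<in> {0..T} \<Longrightarrow> continuous_on UNIV (\<lambda>(x, u). jx t x u)"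
    using j_diff by metis
  \<comment> \<open>Centring the penalty at \<open>ref\<close> instead of \<open>us\<close> brings
    it under \<open>square_integrable_admissible\<close>; the two differ only on a null set.\<close>
  define h where "h t x u = j t x u + (norm (u - ref t))\<^sup>2 / 2" for t x u
  have j_m: "(\<lambda>(t, z). j t (fst z) (snd z)) \<in> borel_measurable (lebesgue_on {0..T} \<Otimes>\<^sub>M borel)"
    using j_normal by (simp add: normal_integrand_def)
  have h_m: "(\<lambda>(t, z). h t (fst z) (snd z)) \<in> borel_measurable (lebesgue_on {0..T} \<Otimes>\<^sub>M borel)"
  proof -
    have [measurable]: "(\<lambda>p. snd (snd p)) \<in> borel_measurable (lebesgue_on {0..T} \<Otimes>\<^sub>M (borel :: ((real^'n) \<times> (real^'m)) measure))"
      by (rule measurable_compose[OF measurable_snd borel_measurable_continuous_onI]) (intro continuous_intros)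
    have [measurable]: "(\<lambda>p. ref (fst p)) \<in> borel_measurable (lebesgue_on {0..T} \<Otimes>\<^sub>M (borel :: ((real^'n) \<times> (real^'m)) measure))"
      by (rule measurable_compose[OF measurable_fst ref(1)])
    have "(\<lambda>p. (norm (snd (snd p) - ref (fst p)))\<^sup>2 / 2) \<in> borel_measurable (lebesgue_on {0..T} \<Otimes>\<^sub>M (borel :: ((real^'n) \<times> (real^'m)) measure))"
      by measurable
    from borel_measurable_add[OF j_m this] show ?thesis by (simp add: h_def case_prod_beta')
  qed
  have cost: "Jk_cost T j ref x u = (\<integral>\<^sup>+ t. ennreal (h t (x t) (u t)) \<partial>lebesgue_on {0..T})"
    if "admissible u" "integral_solution u x" for u x
    unfolding h_def using that ref' j_nonneg
    by (intro Jk_cost_eq_nn_integral cost_measurable[OF j_m] square_integrable_admissible)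
      (auto simp: integral_solution_def admissible_def)
  define E where "E u = (\<integral>t. (norm (u t - ref t))\<^sup>2 \<partial>lebesgue_on {0..T})" for u
  have L2: "L2dist T u ref \<le> \<delta> \<longleftrightarrow> E u \<le> \<delta>\<^sup>2" for u
    using \<open>\<delta> > 0\<close> by (auto simp: L2dist_def E_def intro: real_le_lsqrt dest: sqrt_le_D)
  have "\<exists>y v. admissible v \<and> E v \<le> \<delta>\<^sup>2 \<and> integral_solution v y \<and>
    (\<forall>x u. admissible u \<and> E u \<le> \<delta>\<^sup>2 \<and> integral_solution u x \<longrightarrow>
      (\<integral>\<^sup>+ t. ennreal (h t (y t) (v t)) \<partial>lebesgue_on {0..T}) \<le> (\<integral>\<^sup>+ t. ennreal (h t (x t) (u t)) \<partial>lebesgue_on {0..T}))"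
    unfolding E_def
  proof (rule optimal_control_exists[OF U(2) ref' zero_le_power2 _ h_m])
    fix t :: real assume t: "t \<in> {0..T}"
    show "0 \<le> h t x u" for x u using j_nonneg t by (simp add: h_def)
    show "convex_on UNIV (h t x)" for x
      unfolding h_def using j_convex t by (intro convex_norm_penalty) auto
    \<comment> \<open>The penalty does not contain the state, so the state gradient is that of
      \<open>j\<close>.\<close>
    show "((\<lambda>y. h t y u) has_derivative (\<lambda>d. jx t x u \<bullet> d)) (at x)" for x u
      unfolding h_def using has_derivative_add[OF jx(1)[OF t] has_derivative_const] by simp
    show "continuous_on UNIV (\<lambda>(x, u). jx t x u)" by (rule jx(2)[OF t])
  qed
  then obtain y v where v: "admissible v" "E v \<le> \<delta>\<^sup>2" "integral_solution v y"
    and min: "\<forall>x u. admissible u \<and> E u \<le> \<delta>\<^sup>2 \<and> integral_solution u x \<longrightarrow>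
      (\<integral>\<^sup>+ t. ennreal (h t (y t) (v t)) \<partial>lebesgue_on {0..T}) \<le> (\<integral>\<^sup>+ t. ennreal (h t (x t) (u t)) \<partial>lebesgue_on {0..T})"
    by (elim exE conjE)
  have opt: "Jk_cost T j ref y v \<le> Jk_cost T j ref x u"
    if "admissible u" "E u \<le> \<delta>\<^sup>2" "integral_solution u x" for x u
    unfolding cost[OF v(1,3)] cost[OF that(1,3)] using min that by simp
  have v_m: "v \<in> borel_measurable (lebesgue_on {0..T})" using v by (simp add: admissible_def)
  have dist: "L2dist T u' ref = L2dist T u us" if "AE t in lebesgue_on {0..T}. u' t = u t"
    "u' \<in> borel_measurable (lebesgue_on {0..T})" "u \<in> borel_measurable (lebesgue_on {0..T})" for u u'
    by (rule L2dist_cong_AE[OF that(1) ref(3) that(3,2) us_m ref(1)])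
  have Jk: "Jk_cost T j ref x u' = Jk_cost T j us x u" if "AE t in lebesgue_on {0..T}. u' t = u t"
    "u' \<in> borel_measurable (lebesgue_on {0..T})" "u \<in> borel_measurable (lebesgue_on {0..T})" for x u u'
    unfolding Jk_cost_def using dist[OF that] Jcost_cong_AE[OF that(1)] by simp
  have "global_solution_Pk F0 F1 k tau T phi U j \<delta> us y v"
    unfolding global_solution_Pk_def
  proof (intro conjI allI impI)
    show "feasible T U v" by (rule feas[OF v(1)])
    show "L2dist T v us \<le> \<delta>" using dist[of v v] v(2) L2[of v] v_m by simp
    show "solves_delay F0 F1 (LIE k tau) tau T phi v y" using v solves by simp
    fix u x assume u: "feasible T U u \<and> L2dist T u us \<le> \<delta> \<and> solves_delay F0 F1 (LIE k tau) tau T phi u x"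
    then obtain u' where u': "u' \<in> borel_measurable (lebesgue_on {0..T})" "\<And>t. u' t \<in> U"
        "AE t in lebesgue_on {0..T}. u' t = u t"
      using feasible_representative[OF _ U(3,1)] by blast
    have u_m: "u \<in> borel_measurable (lebesgue_on {0..T})" using u by (simp add: feasible_def)
    have adm: "admissible u'" using u' by (simp add: admissible_def)
    \<comment> \<open>An arbitrary competitor is compared through its admissible representative,
      which has the same state, distance and cost.\<close>
    have "Jk_cost T j ref y v \<le> Jk_cost T j ref x u'"
    proof (rule opt[OF adm])
      show "E u' \<le> \<delta>\<^sup>2" using dist[OF u'(3,1) u_m] u L2 by metis
      show "integral_solution u' x"
        using u solves[OF adm] solves_delay_cong_AE[OF u'(3)] by blast
    qed
    then show "Jk_cost T j us y v \<le> Jk_cost T j us x u"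
      using Jk[OF u'(3,1) u_m] Jk[of v v] v_m by simp
  qed
  then show "\<exists>xk uk. global_solution_Pk F0 F1 k tau T phi U j \<delta> us xk uk" by blast
qed

end
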